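(* Let $k_0$ be a fragmentation kernel and let $u_0:(0,\infty)\to[0,\infty)$ be an initial datum with $\int_0^\infty u_0(x)(1+x)\,dx<\infty$. Let $p_0,q_0$ be the exponents associated with $u_0$, with $q_0<+\infty$. Assume that for all $\nu\in(p_0,q_0)$: $$\int_0^\infty |u_0'(x)|x^\nu dx<\infty,\quad \lim_{x\to0}x^\nu u_0(x)=\lim_{x\to\infty}x^\nu u_0(x)=0,$$ $$\int_0^\infty |u_0''(x)|x^{1+\nu}dx<\infty,\quad \lim_{x\to0}x^{1+\nu}u_0'(x)=\lim_{x\to\infty}x^{1+\nu}u_0'(x)=0.$$ Assume moreover that there exist $a_0>0$, $r>q_0$ and positive constants $C_1,C_2$ such that $$|u_0(x)-a_0x^{-q_0}|\le C_1x^{-r},\qquad |u_0'(x)+a_0q_0x^{-q_0-1}|\le C_2x^{-r-1}\qquad\forall x>1,$$ $$\int_1^\infty x^{\nu+1}\left|u_0''(x)-a_0q_0(q_0+1)x^{-q_0-2}\right|dx<\infty\qquad\forall\nu\in(q_0,r).$$ Let $u$ be the solution of the fragmentation equation with initial datum $u_0$. Then, for all $\delta>0$ arbitrarily small, $$u(t,x)=a_0\,x^{-q_0}\,e^{(K(q_0)-1)t}\left(1+\mathcal O\left(e^{(K(r-\delta)-K(q_0))t}\right)\right)$$ as $t\to\infty$, uniformly for all $x\ge1$.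
   Context: A fragmentation kernel is a finite nonnegative measure $k_0$ with support contained in $[0,1]$ (written $k_0(z)dz$; integrals $\int_0^1$ against it are over $(0,1]$) such that $\int_0^1 z\,k_0(z)dz=1$ and $\int_0^1k_0(z)dz>1$. Its Mellin transform is $K(s)=\int_0^1 z^{s-1}k_0(z)dz$. The fragmentation equation is $$\partial_t u(t,x)+u(t,x)=\int_x^\infty\frac1y k_0\left(\frac xy\right)u(t,y)\,dy,\qquad u(0,x)=u_0(x),\qquad t>0,\ x>0,$$ where for a measure $k_0$ the right-hand side means $\int_{(0,1]}u(t,x/z)\,z^{-1}k_0(dz)$. For the initial datum $u_0$: $U_0(s)=\int_0^\infty x^{s-1}u_0(x)dx$, $I(u_0)=\{p\in\mathbb R:\int_0^\infty u_0(x)x^{p-1}dx<\infty\}$ (an interval containing $[1,2]$), $p_0=\inf I(u_0)\in[-\infty,1]$, $q_0=\sup I(u_0)\in[2,+\infty]$. "The solution $u$" is the unique function in $C([0,\infty);L^1((1+x)dx))\cap C^1((0,\infty);L^1((1+x)dx))$ satisfying the equation and initial condition for all $t>0$ and almost every $x>0$; it is given by $u(t,x)=\frac1{2\pi i}\int_{\nu-i\infty}^{\nu+i\infty}U_0(s)e^{(K(s)-1)t}x^{-s}ds$ for $\nu\in(1,2)$. *)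

theory Defs
  imports "HOL-Analysis.Analysis"
begin

text \<open>The kernel may have an atom at 0, but all integrals are over \<open>(0,1]\<close>.\<close>

definition fragmentation_kernel :: "real measure \<Rightarrow> bool" where
  "fragmentation_kernel k0 \<longleftrightarrow>
     finite_measure k0 \<and> sets k0 = sets borel \<and> emeasure k0 (- {0..1}) = 0 \<and>
     (LINT z:{0<..1}|k0. z) = 1 \<and> (LINT z:{0<..1}|k0. (1::real)) > 1"

text \<open>The two Mellin transforms are polymorphic so that the argument can be real or complex.\<close>

definition mellin_kernel ::
    "real measure \<Rightarrow> 'a::{ln, real_normed_field, second_countable_topology} \<Rightarrow> 'a" where
  "mellin_kernel k0 s = (LINT z:{0<..1}|k0. of_real z powr (s - 1))"

definition mellin_datum ::
    "(real \<Rightarrow> real) \<Rightarrow> 'a::{ln, real_normed_field, second_countable_topology} \<Rightarrow> 'a" where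
  "mellin_datum u0 s = (LINT x:{0<..}|lborel. of_real x powr (s - 1) * of_real (u0 x))"

definition moment_exponents :: "(real \<Rightarrow> real) \<Rightarrow> real set" where
  "moment_exponents u0 = {p. set_integrable lborel {0<..} (\<lambda>x. u0 x * x powr (p - 1))}"

definition lower_exponent :: "(real \<Rightarrow> real) \<Rightarrow> ereal" where
  "lower_exponent u0 = Inf (ereal ` moment_exponents u0)"

definition upper_exponent :: "(real \<Rightarrow> real) \<Rightarrow> ereal" where
  "upper_exponent u0 = Sup (ereal ` moment_exponents u0)"

text \<open>Elements of \<open>L\<^sup>1((0,\<infinity>); (1+x)dx)\<close> are represented by Borel functions; values
  outside \<open>(0,\<infinity>)\<close> are irrelevant.\<close>

definition in_wL1 :: "(real \<Rightarrow> real) \<Rightarrow> bool" where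
  "in_wL1 f \<longleftrightarrow> set_integrable lborel {0<..} (\<lambda>x. (1 + x) * f x)"

definition wL1_norm :: "(real \<Rightarrow> real) \<Rightarrow> real" where
  "wL1_norm f = (LINT x:{0<..}|lborel. (1 + x) * \<bar>f x\<bar>)"

definition wL1_continuous_on :: "real set \<Rightarrow> (real \<Rightarrow> real \<Rightarrow> real) \<Rightarrow> bool" where
  "wL1_continuous_on T u \<longleftrightarrow>
     (\<forall>t\<in>T. in_wL1 (u t) \<and>
        ((\<lambda>s. wL1_norm (\<lambda>x. u s x - u t x)) \<longlongrightarrow> 0) (at t within T))"

definition wL1_has_derivative :: "(real \<Rightarrow> real \<Rightarrow> real) \<Rightarrow> (real \<Rightarrow> real) \<Rightarrow> real \<Rightarrow> bool" where
  "wL1_has_derivative u v t \<longleftrightarrow> in_wL1 v \<and>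
     ((\<lambda>h. wL1_norm (\<lambda>x. (u (t + h) x - u t x) / h - v x)) \<longlongrightarrow> 0) (at 0)"

text \<open>The time derivative \<open>du\<close> is the derivative as a map into the weighted \<open>L\<^sup>1\<close> space.\<close>

definition fragmentation_solution ::
    "real measure \<Rightarrow> (real \<Rightarrow> real) \<Rightarrow> (real \<Rightarrow> real \<Rightarrow> real) \<Rightarrow> bool" where
  "fragmentation_solution k0 u0 u \<longleftrightarrow>
     wL1_continuous_on {0..} u \<and>
     (AE x in lborel. x > 0 \<longrightarrow> u 0 x = u0 x) \<and>
     (\<exists>du. wL1_continuous_on {0<..} du \<and>
        (\<forall>t>0. wL1_has_derivative u (du t) t \<and>
           (AE x in lborel. x > 0 \<longrightarrow>
              du t x + u t x = (LINT z:{0<..1}|k0. u t (x / z) / z))))"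

text \<open>Inverse Mellin integral
  \<open>1/(2\<pi>i) \<integral> U\<^sub>0(s) e\<^bsup>(K(s)-1)t\<^esup> x\<^bsup>-s\<^esup> ds\<close> along \<open>s = \<nu> + i y\<close>, where \<open>ds = i dy\<close>.\<close>

definition mellin_solution ::
    "real measure \<Rightarrow> (real \<Rightarrow> real) \<Rightarrow> real \<Rightarrow> real \<Rightarrow> real \<Rightarrow> complex" where
  "mellin_solution k0 u0 \<nu> t x =
     1 / (2 * of_real pi) *
     (LINT y|lborel. (let s = Complex \<nu> y in
        mellin_datum u0 s * exp ((mellin_kernel k0 s - 1) * of_real t) * of_real x powr (- s)))"

text \<open>A solution is only determined up to null sets in \<open>x\<close>; its pointwise values are those of the
  inverse Mellin integral.\<close>

definition pointwise_version ::
    "real measure \<Rightarrow> (real \<Rightarrow> real) \<Rightarrow> (real \<Rightarrow> real \<Rightarrow> real) \<Rightarrow> (real \<Rightarrow> real \<Rightarrow> real) \<Rightarrow> bool" where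
  "pointwise_version k0 u0 u w \<longleftrightarrow>
     (\<forall>t>0. (AE x in lborel. x > 0 \<longrightarrow> u t x = w t x) \<and>
        (\<forall>x>0. \<forall>\<nu>\<in>{1<..<2}. complex_of_real (w t x) = mellin_solution k0 u0 \<nu> t x))"

end

theory Submission
  imports Defs "HOL-Probability.Levy"
begin

text \<open>
  On the right-hand side of the equation stands the gain operator
  \<open>T f x = \<integral>\<^sub>(\<^sub>0\<^sub>,\<^sub>1\<^sub>] f (x/z) z\<^sup>-\<^sup>1 k\<^sub>0(dz)\<close>, so the equation reads \<open>\<partial>\<^sub>t u = (T - 1) u\<close> and its solution is
  \<open>e\<^bsup>-t\<^esup> \<Sum> t\<^sup>n/n! T\<^sup>n u\<^sub>0\<close>, called \<open>frag_semigroup\<close> below. This series, rather than a contour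
  integral, yields the asymptotics. A power \<open>x\<^bsup>-q\<^esup>\<close> is an eigenfunction of \<open>T\<close> with
  eigenvalue \<open>K(q)\<close>. As \<open>z \<le> 1\<close>, the value of \<open>T f\<close> at \<open>x\<close> depends only on \<open>f\<close> on \<open>[x, \<infinity>)\<close>, and
  \<open>T\<close> is monotone. The bound \<open>\<bar>u\<^sub>0 - a\<^sub>0 x\<^bsup>-q\<^esup>\<bar> \<le> C\<^sub>1 x\<^bsup>-r\<^esup>\<close> on \<open>[1, \<infinity>)\<close> (with \<open>q = q\<^sub>0\<close>) therefore turns into
  \<open>\<bar>T\<^sup>n u\<^sub>0 - a\<^sub>0 K(q)\<^sup>n x\<^bsup>-q\<^esup>\<bar> \<le> C\<^sub>1 K(r)\<^sup>n x\<^bsup>-r\<^esup>\<close> on the same half-line, and summing over \<open>n\<close> gives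
  \<open>\<bar>u(t,x) - a\<^sub>0 x\<^bsup>-q\<^esup> e\<^bsup>(K(q)-1)t\<^esup>\<bar> \<le> C\<^sub>1 x\<^bsup>-r\<^esup> e\<^bsup>(K(r)-1)t\<^esup>\<close> (\<open>frag_semigroup_power_approx\<close>). Finally
  \<open>K(r) \<le> K(r - \<delta>)\<close> because \<open>K\<close> is nonincreasing.

  It remains to see that the series is the right object. The Mellin transform turns \<open>T\<close> into
  multiplication by \<open>K\<close> (\<open>gain_mellin\<close>), and on the side of inverse Mellin integrals \<open>T\<close> likewise
  multiplies the integrand by \<open>K\<close> (\<open>gain_inverse_mellin\<close>).

  The series equals the inverse Mellin integral at every point and for every abscissa
  (\<open>frag_semigroup_eq_mellin_solution\<close>): two integrations by parts give \<open>U\<^sub>0(\<nu> + iy) = O(1/y\<^sup>2)\<close>, so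
  Mellin inversion holds for \<open>u\<^sub>0\<close>; applying \<open>T\<^sup>n\<close> and summing produces the factor
  \<open>e\<^bsup>(K(s)-1)t\<^esup>\<close>.

  The series is almost everywhere equal to the given solution (\<open>solution_eq_frag_semigroup\<close>): the
  Mellin transform of the solution solves the scalar equation \<open>M' = (K(s) - 1) M\<close>, hence coincides
  with that of the series, and the Mellin transform on a vertical line is injective
  (\<open>mellin_unique\<close>, which rests on the uniqueness theorem of Levy for characteristic functions).
\<close>

section \<open>Fourier inversion and uniqueness on the line\<close>

lemma std_normal_char:
  "(LBINT v. of_real (std_normal_density v) * exp (\<i> * of_real (a * v))) =
     complex_of_real (sqrt (2 * pi) * std_normal_density a)"
proof -
  have "complex_of_real (exp (- a\<^sup>2 / 2)) = char std_normal_distribution a"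
    by (simp add: char_std_normal_distribution)
  also have "\<dots> = (LBINT v. std_normal_density v *\<^sub>R exp (\<i> * of_real (a * v)))"
    unfolding char_def by (subst integral_density) auto
  finally show ?thesis
    by (simp add: std_normal_density_def scaleR_conv_of_real)
qed

lemma integrable_std_normal: "integrable lborel std_normal_density"
  using integrable_std_normal_moment[of 0] by simp

text \<open>The Gaussian cut-off in \<open>fourier_inversion\<close>: the Fourier transform of \<open>\<tau> \<mapsto> \<gamma>(e\<tau>)\<close>, with \<open>\<gamma>\<close> the
  standard normal density, is an approximate identity of width \<open>e\<close> up to the factor \<open>\<surd>(2\<pi>)\<close>.\<close>

lemma std_normal_char_scaled:
  assumes "e > 0"
  shows "(LBINT \<tau>. of_real (std_normal_density (e * \<tau>)) * exp (\<i> * of_real (a * \<tau>))) =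
     complex_of_real (sqrt (2 * pi) * std_normal_density (a / e) / e)"
proof -
  have "(LBINT v. of_real (std_normal_density v) * exp (\<i> * of_real (a / e * v)))
     = \<bar>e\<bar> *\<^sub>R (LBINT \<tau>. of_real (std_normal_density (0 + e * \<tau>)) * exp (\<i> * of_real (a / e * (0 + e * \<tau>))))"
    by (rule lborel_integral_real_affine) (use assms in auto)
  also have "(\<lambda>\<tau>. a / e * (0 + e * \<tau>)) = (\<lambda>\<tau>. a * \<tau>)" using assms by auto
  finally show ?thesis
    unfolding std_normal_char using assms by (simp add: scaleR_conv_of_real field_simps)
qed

text \<open>Damping the inversion integral by a Gaussian makes Fubini applicable and turns it into the
  convolution of \<open>f\<close> with a Gaussian of width \<open>e\<close>. As \<open>e \<rightarrow> 0\<close>, the damped integral tends to the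
  undamped one because the transform is integrable, and the convolution tends to \<open>f h\<close> because
  \<open>f\<close> is bounded and continuous at \<open>h\<close>.\<close>

theorem fourier_inversion:
  fixes f :: "real \<Rightarrow> complex"
  assumes f: "integrable lborel f" and bdd: "\<And>y. norm (f y) \<le> B" and cont: "isCont f h"
    and F: "integrable lborel (\<lambda>\<tau>. LBINT y. f y * exp (\<i> * of_real (\<tau> * y)))"
  shows "f h = 1 / (2 * of_real pi) *
    (LBINT \<tau>. (LBINT y. f y * exp (\<i> * of_real (\<tau> * y))) * exp (- \<i> * of_real (\<tau> * h)))"
proof -
  define F where "F = (\<lambda>\<tau>. LBINT y. f y * exp (\<i> * of_real (\<tau> * y)))"
  have F': "integrable lborel F" using assms(4) by (simp add: F_def)
  note [measurable] = borel_measurable_integrable[OF f] borel_measurable_integrable[OF F']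
  let ?g = std_normal_density
  \<comment> \<open>Gaussian damping of the inversion integral equals Gaussian smoothing of \<open>f\<close>.\<close>
  have smoothed: "(LBINT \<tau>. F \<tau> * exp (- \<i> * of_real (\<tau> * h)) * of_real (?g (e * \<tau>)))
      = of_real (sqrt (2 * pi)) * (LBINT v. f (h + e * v) * of_real (?g v))" if e: "e > 0" for e
  proof -
    have ge: "integrable lborel (\<lambda>\<tau>. ?g (e * \<tau>))"
      using lborel_integrable_real_affine[OF integrable_std_normal, of e 0] e by simp
    have "integrable (lborel \<Otimes>\<^sub>M lborel)
        (\<lambda>(\<tau>, y). f y * exp (\<i> * of_real (\<tau> * (y - h))) * of_real (?g (e * \<tau>)))"
    proof (rule lborel_pair.Fubini_integrable)
      have "integrable lborel (\<lambda>\<tau>. ?g (e * \<tau>) * (LBINT y. norm (f y)))"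
        by (rule integrable_mult_left) (use ge in auto)
      then show "integrable lborel (\<lambda>\<tau>. LBINT y. norm (case (\<tau>, y) of (\<tau>, y) \<Rightarrow>
          f y * exp (\<i> * of_real (\<tau> * (y - h))) * of_real (?g (e * \<tau>))))"
        by (simp add: norm_mult mult.commute)
      show "AE \<tau> in lborel. integrable lborel (\<lambda>y. case (\<tau>, y) of (\<tau>, y) \<Rightarrow>
          f y * exp (\<i> * of_real (\<tau> * (y - h))) * of_real (?g (e * \<tau>)))"
      proof (rule AE_I2)
        fix \<tau> :: real
        have "integrable lborel (\<lambda>y. f y * exp (\<i> * of_real (\<tau> * (y - h))))"
          by (rule Bochner_Integration.integrable_bound[OF f]) (auto simp: norm_mult)
        then show "integrable lborel (\<lambda>y. case (\<tau>, y) of (\<tau>, y) \<Rightarrow>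
          f y * exp (\<i> * of_real (\<tau> * (y - h))) * of_real (?g (e * \<tau>)))" by simp
      qed
    qed measurable
    from lborel_pair.Fubini_integral[OF this]
    have "(LBINT y. LBINT \<tau>. f y * exp (\<i> * of_real (\<tau> * (y - h))) * of_real (?g (e * \<tau>)))
        = (LBINT \<tau>. LBINT y. f y * exp (\<i> * of_real (\<tau> * (y - h))) * of_real (?g (e * \<tau>)))" by simp
    also have "\<dots> = (LBINT \<tau>. F \<tau> * exp (- \<i> * of_real (\<tau> * h)) * of_real (?g (e * \<tau>)))"
    proof (rule Bochner_Integration.integral_cong[OF refl])
      fix \<tau> :: real
      have "(\<lambda>y. f y * exp (\<i> * of_real (\<tau> * (y - h))) * of_real (?g (e * \<tau>))) =
         (\<lambda>y. f y * exp (\<i> * of_real (\<tau> * y)) * (exp (- \<i> * of_real (\<tau> * h)) * of_real (?g (e * \<tau>))))"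
        by (auto simp: algebra_simps exp_diff exp_minus divide_simps exp_add)
      then show "(LBINT y. f y * exp (\<i> * of_real (\<tau> * (y - h))) * of_real (?g (e * \<tau>))) =
         F \<tau> * exp (- \<i> * of_real (\<tau> * h)) * of_real (?g (e * \<tau>))"
        unfolding F_def by (simp only: integral_mult_left_zero) (simp only: mult.assoc)
    qed
    also have "(LBINT y. LBINT \<tau>. f y * exp (\<i> * of_real (\<tau> * (y - h))) * of_real (?g (e * \<tau>)))
        = (LBINT y. f y * of_real (sqrt (2 * pi) * ?g ((y - h) / e) / e))"
    proof (rule Bochner_Integration.integral_cong[OF refl])
      fix y
      have "(\<lambda>\<tau>. f y * exp (\<i> * of_real (\<tau> * (y - h))) * of_real (?g (e * \<tau>))) =
         (\<lambda>\<tau>. f y * (of_real (?g (e * \<tau>)) * exp (\<i> * of_real ((y - h) * \<tau>))))"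
        by (auto simp: mult_ac)
      then show "(LBINT \<tau>. f y * exp (\<i> * of_real (\<tau> * (y - h))) * of_real (?g (e * \<tau>))) =
         f y * of_real (sqrt (2 * pi) * ?g ((y - h) / e) / e)"
        using std_normal_char_scaled[OF e, of "y - h"] by simp
    qed
    also have "\<dots> = e *\<^sub>R (LBINT v. f (h + e * v) * of_real (sqrt (2 * pi) * ?g v / e))"
      using e by (subst lborel_integral_real_affine[of e _ h]) (auto simp del: of_real_mult of_real_divide)
    also have "(\<lambda>v. f (h + e * v) * of_real (sqrt (2 * pi) * ?g v / e)) =
        (\<lambda>v. complex_of_real (sqrt (2 * pi) / e) * (f (h + e * v) * of_real (?g v)))"
      by (auto simp: mult_ac)
    also have "e *\<^sub>R (LBINT v. \<dots> v) = of_real (sqrt (2 * pi)) * (LBINT v. f (h + e * v) * of_real (?g v))"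
      using e by (simp add: scaleR_conv_of_real del: of_real_mult)
    finally show ?thesis by simp
  qed
  define e where "e = (\<lambda>n::nat. 1 / real (Suc n))"
  have e0: "e n > 0" for n by (simp add: e_def)
  have e_lim: "e \<longlonglongrightarrow> 0" unfolding e_def
    using LIMSEQ_inverse_real_of_nat by (simp add: inverse_eq_divide)
  have "(\<lambda>n. LBINT \<tau>. F \<tau> * exp (- \<i> * of_real (\<tau> * h)) * of_real (?g (e n * \<tau>)))
     \<longlonglongrightarrow> (LBINT \<tau>. F \<tau> * exp (- \<i> * of_real (\<tau> * h)) * of_real (?g 0))"
  proof (rule integral_dominated_convergence[where w = "\<lambda>\<tau>. norm (F \<tau>)"])
    show "integrable lborel (\<lambda>\<tau>. norm (F \<tau>))" using F' by simp
    show "AE \<tau> in lborel. (\<lambda>n. F \<tau> * exp (- \<i> * of_real (\<tau> * h)) * of_real (?g (e n * \<tau>)))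
       \<longlonglongrightarrow> F \<tau> * exp (- \<i> * of_real (\<tau> * h)) * of_real (?g 0)"
    proof (rule AE_I2, rule tendsto_mult[OF tendsto_const], rule tendsto_of_real)
      fix \<tau>
      have "(\<lambda>n. e n * \<tau>) \<longlonglongrightarrow> 0" using e_lim by (auto intro: tendsto_eq_intros)
      moreover have "isCont ?g 0" unfolding std_normal_density_def by (intro continuous_intros) auto
      ultimately show "(\<lambda>n. ?g (e n * \<tau>)) \<longlonglongrightarrow> ?g 0" using isCont_tendsto_compose by blast
    qed
    have g1: "?g v \<le> 1" for v
    proof -
      have "?g v = exp (- v\<^sup>2 / 2) / sqrt (2 * pi)" by (simp add: std_normal_density_def)
      also have "\<dots> \<le> 1 / 1"
        using pi_ge_two by (intro frac_le) auto
      finally show ?thesis by simp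
    qed
    show "AE \<tau> in lborel. norm (F \<tau> * exp (- \<i> * of_real (\<tau> * h)) * of_real (?g (e n * \<tau>))) \<le> norm (F \<tau>)" for n
      by (auto simp: norm_mult intro!: AE_I2 mult_left_le g1)
  qed measurable
  then have "(\<lambda>n. of_real (sqrt (2 * pi)) * (LBINT v. f (h + e n * v) * of_real (?g v)))
     \<longlonglongrightarrow> (LBINT \<tau>. F \<tau> * exp (- \<i> * of_real (\<tau> * h)) * of_real (?g 0))"
    by (simp only: smoothed[OF e0])
  moreover have "(\<lambda>n. of_real (sqrt (2 * pi)) * (LBINT v. f (h + e n * v) * of_real (?g v)))
     \<longlonglongrightarrow> of_real (sqrt (2 * pi)) * (LBINT v. f h * of_real (?g v))"
  proof (rule tendsto_mult[OF tendsto_const],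
         rule integral_dominated_convergence[where w = "\<lambda>v. B * ?g v"])
    show "integrable lborel (\<lambda>v. B * ?g v)" using integrable_std_normal by simp
    show "AE v in lborel. (\<lambda>n. f (h + e n * v) * of_real (?g v)) \<longlonglongrightarrow> f h * of_real (?g v)"
    proof (rule AE_I2, rule tendsto_mult[OF _ tendsto_const])
      fix v
      have "(\<lambda>n. h + e n * v) \<longlonglongrightarrow> h + 0 * v" by (intro tendsto_intros e_lim)
      then have "(\<lambda>n. h + e n * v) \<longlonglongrightarrow> h" by simp
      then show "(\<lambda>n. f (h + e n * v)) \<longlonglongrightarrow> f h" using cont isCont_tendsto_compose by blast
    qed
    show "AE v in lborel. norm (f (h + e n * v) * of_real (?g v)) \<le> B * ?g v" for n
      by (auto simp: norm_mult intro!: AE_I2 mult_right_mono bdd)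
  qed measurable
  ultimately have "of_real (sqrt (2 * pi)) * (LBINT v. f h * of_real (?g v)) =
     (LBINT \<tau>. F \<tau> * exp (- \<i> * of_real (\<tau> * h)) * of_real (?g 0))"
    using LIMSEQ_unique by blast
  moreover have "(LBINT v. f h * complex_of_real (?g v)) = f h"
    using integral_std_normal_moment_even[of 0] by simp
  moreover have "(LBINT \<tau>. F \<tau> * exp (- \<i> * of_real (\<tau> * h)) * of_real (?g 0)) =
     (LBINT \<tau>. F \<tau> * exp (- \<i> * of_real (\<tau> * h))) / of_real (sqrt (2 * pi))"
    by (simp add: std_normal_density_def)
  ultimately have "complex_of_real (sqrt (2 * pi)) * f h =
     (LBINT \<tau>. F \<tau> * exp (- \<i> * of_real (\<tau> * h))) / complex_of_real (sqrt (2 * pi))" by simp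
  then have "f h * (complex_of_real (sqrt (2 * pi)) * complex_of_real (sqrt (2 * pi)))
       = (LBINT \<tau>. F \<tau> * exp (- \<i> * of_real (\<tau> * h)))"
    by (simp add: field_simps del: of_real_mult)
  also have "complex_of_real (sqrt (2 * pi)) * complex_of_real (sqrt (2 * pi)) = 2 * of_real pi"
    by (subst of_real_mult[symmetric]) simp
  finally show ?thesis unfolding F_def by (simp add: field_simps)
qed

text \<open>Split \<open>k\<close> into positive and negative part. The vanishing transform says that both parts have
  the same mass and, once normalised to probability densities, the same characteristic function.\<close>

lemma fourier_unique:
  fixes k :: "real \<Rightarrow> real"
  assumes int: "integrable lborel k"
    and zero: "\<And>\<tau>. (LBINT y. of_real (k y) * exp (\<i> * of_real (\<tau> * y))) = 0"
  shows "AE y in lborel. k y = 0"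
proof -
  define p n where "p = (\<lambda>y. max 0 (k y))" and "n = (\<lambda>y. max 0 (- k y))"
  have pn: "p y \<ge> 0" "n y \<ge> 0" "k y = p y - n y" for y by (auto simp: p_def n_def)
  have int_p: "integrable lborel p" and int_n: "integrable lborel n"
    unfolding p_def n_def using int by auto
  note [measurable] = borel_measurable_integrable[OF int_p] borel_measurable_integrable[OF int_n]
  have osc: "integrable lborel (\<lambda>y. of_real (q y) * exp (\<i> * of_real (\<tau> * y)))"
    if "integrable lborel q" for q :: "real \<Rightarrow> real" and \<tau>
    by (rule Bochner_Integration.integrable_bound[OF that]) (use that in \<open>auto simp: norm_mult\<close>)
  have eq: "(LBINT y. of_real (p y) * exp (\<i> * of_real (\<tau> * y))) = (LBINT y. of_real (n y) * exp (\<i> * of_real (\<tau> * y)))" for \<tau>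
  proof -
    have "(\<lambda>y. of_real (k y) * exp (\<i> * of_real (\<tau> * y))) =
       (\<lambda>y. of_real (p y) * exp (\<i> * of_real (\<tau> * y)) - of_real (n y) * exp (\<i> * of_real (\<tau> * y)))"
      by (auto simp: pn(3) algebra_simps)
    with zero[of \<tau>] show ?thesis
      using osc[OF int_p, of \<tau>] osc[OF int_n, of \<tau>] by simp
  qed
  define m where "m = (LBINT y. p y)"
  have mn: "m = (LBINT y. n y)"
    using eq[of 0] by (simp add: m_def)
  have m0: "m \<ge> 0" unfolding m_def using pn by (intro integral_nonneg_AE) auto
  show ?thesis
  proof (cases "m = 0")
    case True
    then have "AE y in lborel. p y = 0" "AE y in lborel. n y = 0"
      using mn integral_nonneg_eq_0_iff_AE[OF int_p] integral_nonneg_eq_0_iff_AE[OF int_n] pn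
      by (auto simp: m_def)
    then show ?thesis by eventually_elim (simp add: pn)
  next
    case False
    with m0 have m: "m > 0" by simp
    define P where "P = (\<lambda>q. density lborel (\<lambda>y::real. ennreal (q y / m)))"
    have dist: "real_distribution (P q)" and
      char: "char (P q) \<tau> = (LBINT y. of_real (q y) * exp (\<i> * of_real (\<tau> * y))) / of_real m"
      if q: "integrable lborel q" "\<And>y. q y \<ge> 0" "(LBINT y. q y) = m" for q :: "real \<Rightarrow> real" and \<tau>
    proof -
      note [measurable] = borel_measurable_integrable[OF q(1)]
      have "emeasure (P q) (space (P q)) = (\<integral>\<^sup>+ y. ennreal (q y / m) \<partial>lborel)"
        unfolding P_def by (subst emeasure_density) auto
      also have "\<dots> = ennreal (LBINT y. q y / m)"
        using q m by (intro nn_integral_eq_integral) auto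
      also have "\<dots> = 1" using q(3) m by simp
      finally have "prob_space (P q)" by (rule prob_spaceI)
      then show "real_distribution (P q)"
        by (auto simp: real_distribution_def real_distribution_axioms_def P_def)
      have "char (P q) \<tau> = (LBINT y. (q y / m) *\<^sub>R exp (\<i> * of_real (\<tau> * y)))"
        unfolding char_def P_def using q m by (subst integral_density) auto
      also have "\<dots> = (LBINT y. of_real (q y) * exp (\<i> * of_real (\<tau> * y)) / of_real m)"
        by (simp add: scaleR_conv_of_real)
      finally show "char (P q) \<tau> = (LBINT y. of_real (q y) * exp (\<i> * of_real (\<tau> * y))) / of_real m"
        by simp
    qed
    have "P p = P n"
    proof (rule Levy_uniqueness)
      show "real_distribution (P p)" "real_distribution (P n)"
        using dist int_p int_n pn mn by (auto simp: m_def)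
      show "char (P p) = char (P n)"
        using char[OF int_p pn(1)] char[OF int_n pn(2)] mn eq by (auto simp: m_def)
    qed
    then have "AE y in lborel. ennreal (p y / m) = ennreal (n y / m)"
      unfolding P_def by (intro sigma_finite_measure.density_unique[OF lborel.sigma_finite_measure_axioms]) auto
    then show ?thesis
      by eventually_elim (use m in \<open>auto simp: pn\<close>)
  qed
qed

section \<open>Integration on the half-line\<close>

definition pos_lborel :: "real measure" where
  "pos_lborel = restrict_space lborel {0<..}"

lemma space_pos_lborel [simp]: "space pos_lborel = {0<..}"
  by (simp add: pos_lborel_def space_restrict_space)

lemma sets_pos_lborel [measurable_cong]: "sets pos_lborel = sets (restrict_space borel {0<..})"
  unfolding pos_lborel_def by (rule sets_restrict_space_cong) simp

lemma sigma_finite_pos_lborel: "sigma_finite_measure pos_lborel"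
  unfolding pos_lborel_def
  by (rule sigma_finite_measure_restrict_space) (auto intro: lborel.sigma_finite_measure_axioms)

lemma borel_measurable_pos_lborelI:
  "f \<in> borel_measurable borel \<Longrightarrow> f \<in> borel_measurable pos_lborel"
  unfolding pos_lborel_def by (rule measurable_restrict_space1) simp

lemma set_integrable_pos_iff:
  fixes f :: "real \<Rightarrow> 'a::{banach, second_countable_topology}"
  shows "set_integrable lborel {0<..} f \<longleftrightarrow> integrable pos_lborel f"
  unfolding set_integrable_def pos_lborel_def by (subst integrable_restrict_space) auto

lemma set_integral_pos_eq:
  fixes f :: "real \<Rightarrow> 'a::{banach, second_countable_topology}"
  shows "(LINT x:{0<..}|lborel. f x) = integral\<^sup>L pos_lborel f"
  unfolding set_lebesgue_integral_def pos_lborel_def by (subst integral_restrict_space) auto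

lemma integral_pos_indicator:
  fixes f :: "real \<Rightarrow> 'a::{banach, second_countable_topology}"
  assumes "S \<subseteq> {0<..}"
  shows "(LINT x|pos_lborel. indicator S x *\<^sub>R f x) = (LINT x:S|lborel. f x)"
  unfolding set_integral_pos_eq[symmetric] set_lebesgue_integral_def
  by (rule Bochner_Integration.integral_cong[OF refl]) (use assms in \<open>auto split: split_indicator\<close>)

lemma AE_pos_iff: "(AE x in pos_lborel. P x) \<longleftrightarrow> (AE x in lborel. x > 0 \<longrightarrow> P x)"
  unfolding pos_lborel_def by (subst AE_restrict_space_iff) auto

lemma mellin_datum_eq:
  "mellin_datum f s = (LINT x|pos_lborel. of_real x powr (s - 1) * of_real (f x))"
  unfolding mellin_datum_def set_integral_pos_eq ..

lemma cpow_pos: "x > 0 \<Longrightarrow> complex_of_real x powr s = exp (s * of_real (ln x))"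
  by (simp add: powr_def Ln_of_real)

lemma norm_cpow: "x > 0 \<Longrightarrow> norm (complex_of_real x powr s) = x powr Re s"
  by (simp add: norm_powr_real_powr)

lemma cpow_add: "complex_of_real x powr s * of_real x powr t = of_real x powr (s + t)"
  by (simp add: powr_add)

lemma cpow_mult: "x > 0 \<Longrightarrow> y > 0 \<Longrightarrow>
    complex_of_real (x * y) powr s = of_real x powr s * of_real y powr s"
  by (simp add: cpow_pos ln_mult distrib_left exp_add del: of_real_mult)

lemma cpow_measurable [measurable]: "(\<lambda>x. complex_of_real x powr s) \<in> borel_measurable pos_lborel"
proof -
  have "(\<lambda>x. exp (s * of_real (ln x))) \<in> borel_measurable pos_lborel"
    by (intro borel_measurable_pos_lborelI) measurable
  then show ?thesis
    by (rule measurable_cong[THEN iffD1, rotated]) (auto simp: cpow_pos)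
qed

text \<open>The derivative is not assumed continuous, so the fundamental theorem is taken on compact
  intervals in its gauge-integral form, where differentiability everywhere suffices.\<close>

lemma integral_derivative_pos_eq_0:
  fixes g g' :: "real \<Rightarrow> complex"
  assumes deriv: "\<And>x. x > 0 \<Longrightarrow> (g has_vector_derivative g' x) (at x)"
    and int: "integrable pos_lborel g'"
    and lim0: "(g \<longlongrightarrow> 0) (at_right 0)" and lim_top: "(g \<longlongrightarrow> 0) at_top"
  shows "(LINT x|pos_lborel. g' x) = 0"
proof -
  let ?a = "\<lambda>n::nat. 1 / real (Suc n)" and ?b = "\<lambda>n::nat. real (Suc n)"
  have ab: "0 < ?a n" "?a n \<le> ?b n" for n by (auto simp: field_simps)
  have int': "set_integrable lborel {0<..} g'" using int by (simp add: set_integrable_pos_iff)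
  have eq: "(LINT x|pos_lborel. indicator {?a n..?b n} x *\<^sub>R g' x) = g (?b n) - g (?a n)" for n
  proof -
    have sub: "{?a n..?b n} \<subseteq> {0<..}"
      by (meson ab(1) atLeastAtMost_iff greaterThan_iff less_le_trans subsetI)
    have "(LINT x|pos_lborel. indicator {?a n..?b n} x *\<^sub>R g' x) = (LINT x:{?a n..?b n}|lborel. g' x)"
      by (rule integral_pos_indicator[OF sub])
    also have "\<dots> = integral {?a n..?b n} g'"
      by (rule set_borel_integral_eq_integral) (rule set_integrable_subset[OF int'], use sub in auto)
    also have "\<dots> = g (?b n) - g (?a n)"
      by (rule integral_unique, rule fundamental_theorem_of_calculus[OF ab(2)])
         (use sub in \<open>auto intro!: has_vector_derivative_at_within[OF deriv]\<close>)
    finally show ?thesis .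
  qed
  have "(\<lambda>n. LINT x|pos_lborel. indicator {?a n..?b n} x *\<^sub>R g' x) \<longlonglongrightarrow> (LINT x|pos_lborel. g' x)"
  proof (rule integral_dominated_convergence[where w = "\<lambda>x. norm (g' x)"])
    show "AE x in pos_lborel. (\<lambda>n. indicator {?a n..?b n} x *\<^sub>R g' x) \<longlonglongrightarrow> g' x"
    proof (rule AE_I2)
      fix x assume "x \<in> space pos_lborel"
      then have x: "x > 0" by simp
      have "\<forall>\<^sub>F n in sequentially. ?a n < x"
        using LIMSEQ_inverse_real_of_nat x by (auto simp: inverse_eq_divide dest!: order_tendstoD(2))
      moreover have "\<forall>\<^sub>F n in sequentially. x < ?b n"
        using filterlim_compose[OF filterlim_real_sequentially filterlim_Suc]
        by (rule filterlim_at_top_dense[THEN iffD1, rule_format])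
      ultimately have "\<forall>\<^sub>F n in sequentially. indicator {?a n..?b n} x *\<^sub>R g' x = g' x"
        by eventually_elim auto
      then show "(\<lambda>n. indicator {?a n..?b n} x *\<^sub>R g' x) \<longlonglongrightarrow> g' x"
        by (rule tendsto_eventually)
    qed
    show "(\<lambda>x. indicator {?a n..?b n} x *\<^sub>R g' x) \<in> borel_measurable pos_lborel" for n
      by (rule borel_measurable_scaleR[OF borel_measurable_pos_lborelI borel_measurable_integrable[OF int]]) simp
  qed (use int in \<open>auto split: split_indicator\<close>)
  moreover have "(\<lambda>n. g (?b n) - g (?a n)) \<longlonglongrightarrow> 0 - 0"
  proof (rule tendsto_diff)
    show "(\<lambda>n. g (?b n)) \<longlonglongrightarrow> 0"
      by (rule filterlim_compose[OF lim_top])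
         (rule filterlim_compose[OF filterlim_real_sequentially filterlim_Suc])
    have "filterlim ?a (at_right 0) sequentially"
      unfolding filterlim_at using LIMSEQ_inverse_real_of_nat by (auto simp: inverse_eq_divide)
    then show "(\<lambda>n. g (?a n)) \<longlonglongrightarrow> 0" by (rule filterlim_compose[OF lim0])
  qed
  ultimately show ?thesis unfolding eq by (simp add: LIMSEQ_unique)
qed

text \<open>The derivative is measurable as a pointwise limit of difference quotients. This lets
  integrability of \<open>\<bar>f'\<bar>\<close> against a weight carry over to \<open>f'\<close> itself.\<close>

lemma measurable_differentiable_pos:
  fixes f f' :: "real \<Rightarrow> real"
  assumes deriv: "\<And>x. x > 0 \<Longrightarrow> (f has_real_derivative f' x) (at x)"
  shows "f \<in> borel_measurable pos_lborel" "f' \<in> borel_measurable pos_lborel"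
proof -
  have "continuous_on {0<..} f"
    using deriv by (auto intro!: continuous_at_imp_continuous_on DERIV_isCont)
  then have f: "f \<in> borel_measurable (restrict_space borel {0<..})"
    by (rule borel_measurable_continuous_on_restrict)
  then show "f \<in> borel_measurable pos_lborel" by measurable
  note [measurable] = f
  define q where "q = (\<lambda>(n::nat) x. (f (x + 1 / real (Suc n)) - f x) / (1 / real (Suc n)))"
  show "f' \<in> borel_measurable pos_lborel"
  proof (rule borel_measurable_LIMSEQ_real)
    fix x assume "x \<in> space pos_lborel"
    then have "((\<lambda>h. (f (x + h) - f x) / h) \<longlongrightarrow> f' x) (at 0)"
      using deriv by (simp add: DERIV_def)
    moreover have "filterlim (\<lambda>n::nat. 1 / real (Suc n)) (at 0) sequentially"
      unfolding filterlim_at using LIMSEQ_inverse_real_of_nat by (auto simp: inverse_eq_divide)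
    ultimately show "(\<lambda>n. q n x) \<longlonglongrightarrow> f' x" unfolding q_def by (rule filterlim_compose)
  next
    fix n
    have [measurable]: "(\<lambda>x. x + 1 / real (Suc n)) \<in> pos_lborel \<rightarrow>\<^sub>M restrict_space borel {0<..}"
      by (rule measurable_restrict_space2) (auto intro!: borel_measurable_pos_lborelI add_pos_pos)
    show "q n \<in> borel_measurable pos_lborel" unfolding q_def by measurable
  qed
qed

lemma exp_substitution:
  fixes f :: "real \<Rightarrow> complex"
  assumes f: "integrable pos_lborel f"
  shows "integrable lborel (\<lambda>y. exp y *\<^sub>R f (exp y))"
    and "(LBINT y. exp y *\<^sub>R f (exp y)) = (LINT x|pos_lborel. f x)"
proof -
  have im: "exp ` (UNIV::real set) = {0<..}"
    by (auto simp: image_iff) (metis exp_ln)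
  have [measurable]: "f \<in> borel_measurable (restrict_space borel {0<..})"
    using borel_measurable_integrable[OF f] by measurable
  have [measurable]: "(exp :: real \<Rightarrow> real) \<in> borel \<rightarrow>\<^sub>M restrict_space borel {0<..}"
    by (rule measurable_restrict_space2) auto
  have m: "(\<lambda>y. exp y *\<^sub>R f (exp y)) \<in> borel_measurable lborel" by measurable
  have f': "set_integrable lborel {0<..} f" using f by (simp add: set_integrable_pos_iff)
  have A: "f absolutely_integrable_on exp ` UNIV"
    unfolding im using f' by (simp add: set_integrable_def integrable_completion borel_measurable_integrable)
  have "(\<lambda>y. \<bar>exp y\<bar> *\<^sub>R f (exp y)) absolutely_integrable_on UNIV \<and>
      integral UNIV (\<lambda>y. \<bar>exp y\<bar> *\<^sub>R f (exp y)) = integral (exp ` UNIV) f"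
    by (subst has_absolute_integral_change_of_variables_real[where h = exp])
      (use A in \<open>auto intro: inj_onI DERIV_exp has_field_derivative_at_within\<close>)
  then have abs: "(\<lambda>y. \<bar>exp y\<bar> *\<^sub>R f (exp y)) absolutely_integrable_on UNIV"
    and eq: "integral UNIV (\<lambda>y. \<bar>exp y\<bar> *\<^sub>R f (exp y)) = integral (exp ` UNIV) f"
    by auto
  show int: "integrable lborel (\<lambda>y. exp y *\<^sub>R f (exp y))"
    using abs m by (simp add: set_integrable_def integrable_completion)
  note eq
  also have "integral (exp ` UNIV) f = (LINT x|pos_lborel. f x)"
    unfolding im set_integral_pos_eq[symmetric] by (rule set_borel_integral_eq_integral(2)[OF f', symmetric])
  finally show "(LBINT y. exp y *\<^sub>R f (exp y)) = (LINT x|pos_lborel. f x)"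
    using int by (simp add: integral_lborel)
qed

lemma pos_scaling:
  fixes g :: "real \<Rightarrow> 'a::euclidean_space"
  assumes g: "integrable pos_lborel g" and z: "z > 0"
  shows "integrable pos_lborel (\<lambda>x. g (x / z))"
    and "(LINT x|pos_lborel. g (x / z)) = z *\<^sub>R (LINT x|pos_lborel. g x)"
proof -
  have ind: "(\<lambda>x. indicator {0<..} (0 + 1 / z * x) *\<^sub>R g (0 + 1 / z * x)) = (\<lambda>x. indicator {0<..} x *\<^sub>R g (x / z))"
    using z by (auto split: split_indicator simp: zero_less_divide_iff)
  have g': "integrable lborel (\<lambda>x. indicator {0<..} x *\<^sub>R g x)"
    using g unfolding set_integrable_pos_iff[symmetric] set_integrable_def .
  from lborel_integrable_real_affine[OF g', of "1 / z" 0] z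
  show "integrable pos_lborel (\<lambda>x. g (x / z))"
    unfolding ind set_integrable_pos_iff[symmetric] set_integrable_def by simp
  from lborel_integral_real_affine[of "1 / z" "\<lambda>x. indicator {0<..} x *\<^sub>R g x" 0] z
  have "(LINT x|pos_lborel. g x) = \<bar>1 / z\<bar> *\<^sub>R (LINT x|pos_lborel. g (x / z))"
    unfolding ind set_integral_pos_eq[symmetric] set_lebesgue_integral_def by simp
  then show "(LINT x|pos_lborel. g (x / z)) = z *\<^sub>R (LINT x|pos_lborel. g x)"
    using z by simp
qed

section \<open>Mellin inversion and uniqueness\<close>

lemma has_vector_derivative_cpow:
  assumes "x > 0"
  shows "((\<lambda>x. complex_of_real x powr s) has_vector_derivative s * of_real x powr (s - 1)) (at x)"
proof (rule has_vector_derivative_real_field)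
  show "((\<lambda>z. z powr s) has_field_derivative s * of_real x powr (s - 1)) (at (complex_of_real x))"
    by (rule has_field_derivative_powr) (use assms in \<open>auto simp: complex_nonpos_Reals_iff\<close>)
qed

lemma measurable_of_weighted:
  fixes f :: "real \<Rightarrow> real"
  assumes "integrable pos_lborel (\<lambda>x. x powr p * f x)"
  shows "f \<in> borel_measurable pos_lborel"
proof -
  have "(\<lambda>x. x powr (- p) * (x powr p * f x)) \<in> borel_measurable pos_lborel"
    by (intro borel_measurable_times borel_measurable_integrable[OF assms] borel_measurable_pos_lborelI)
       measurable
  then show ?thesis
    by (rule measurable_cong[THEN iffD1, rotated]) (auto simp: powr_add[symmetric] simp flip: mult.assoc)
qed

lemma integrable_mellin:
  assumes "integrable pos_lborel (\<lambda>x. x powr (Re s - 1) * f x)"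
  shows "integrable pos_lborel (\<lambda>x. of_real x powr (s - 1) * complex_of_real (f x))"
proof (rule Bochner_Integration.integrable_bound[OF assms])
  have [measurable]: "f \<in> borel_measurable pos_lborel" by (rule measurable_of_weighted[OF assms])
  show "(\<lambda>x. of_real x powr (s - 1) * complex_of_real (f x)) \<in> borel_measurable pos_lborel"
    by measurable
qed (auto intro!: AE_I2 simp: norm_mult norm_cpow abs_mult)

lemma mellin_by_parts:
  fixes f f' :: "real \<Rightarrow> real"
  assumes deriv: "\<And>x. x > 0 \<Longrightarrow> (f has_real_derivative f' x) (at x)"
    and int: "integrable pos_lborel (\<lambda>x. x powr (Re s - 1) * f x)"
    and int': "integrable pos_lborel (\<lambda>x. x powr Re s * f' x)"
    and lim0: "((\<lambda>x. x powr Re s * f x) \<longlongrightarrow> 0) (at_right 0)"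
    and lim_top: "((\<lambda>x. x powr Re s * f x) \<longlongrightarrow> 0) at_top"
  shows "s * mellin_datum f s = - mellin_datum f' (s + 1)"
proof -
  let ?g = "\<lambda>x. complex_of_real x powr s * of_real (f x)"
  have i1: "integrable pos_lborel (\<lambda>x. complex_of_real x powr (s - 1) * of_real (f x))"
    using integrable_mellin[OF int] .
  have i2: "integrable pos_lborel (\<lambda>x. complex_of_real x powr s * of_real (f' x))"
    using integrable_mellin[of "s + 1" f'] int' by simp
  have lim: "(?g \<longlongrightarrow> 0) F" if "((\<lambda>x. x powr Re s * f x) \<longlongrightarrow> 0) F" "eventually (\<lambda>x. x > 0) F" for F
  proof (rule tendsto_norm_zero_cancel)
    have "((\<lambda>x. \<bar>x powr Re s * f x\<bar>) \<longlongrightarrow> 0) F" using that(1) by (rule tendsto_rabs_zero)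
    then show "((\<lambda>x. norm (?g x)) \<longlongrightarrow> 0) F"
      by (rule Lim_transform_eventually)
         (use that(2) in eventually_elim, auto simp: norm_mult norm_cpow abs_mult)
  qed
  have "(LINT x|pos_lborel. s * (of_real x powr (s - 1) * of_real (f x)) + of_real x powr s * of_real (f' x)) = 0"
  proof (rule integral_derivative_pos_eq_0)
    show "integrable pos_lborel (\<lambda>x. s * (of_real x powr (s - 1) * of_real (f x)) + of_real x powr s * of_real (f' x))"
      using i1 i2 by simp
    show "(?g \<longlongrightarrow> 0) (at_right 0)" using lim[OF lim0] by (simp add: eventually_at_right_less)
    show "(?g \<longlongrightarrow> 0) at_top" using lim[OF lim_top] by (simp add: eventually_gt_at_top)
    fix x :: real assume x: "x > 0"
    have "((\<lambda>x. complex_of_real (f x)) has_vector_derivative of_real (f' x)) (at x)"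
      using deriv[OF x] by (intro has_vector_derivative_of_real) (simp add: has_real_derivative_iff_has_vector_derivative)
    from has_vector_derivative_mult[OF has_vector_derivative_cpow[OF x] this]
    show "(?g has_vector_derivative (s * (of_real x powr (s - 1) * of_real (f x)) + of_real x powr s * of_real (f' x))) (at x)"
      by (simp add: add.commute mult.assoc)
  qed
  then have "s * (LINT x|pos_lborel. of_real x powr (s - 1) * of_real (f x)) +
      (LINT x|pos_lborel. of_real x powr s * of_real (f' x)) = 0"
    using i1 i2 by simp
  then show ?thesis unfolding mellin_datum_eq by (simp add: eq_neg_iff_add_eq_0)
qed

text \<open>Under \<open>x = e\<^sup>y\<close> the Mellin transform on the line \<open>Re s = \<nu>\<close> is the Fourier transform of
  \<open>e\<^bsup>\<nu>y\<^esup> f(e\<^sup>y)\<close>.\<close>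

lemma mellin_substitution:
  assumes int: "integrable pos_lborel (\<lambda>x. x powr (\<nu> - 1) * f x)"
  defines "g \<equiv> (\<lambda>y. complex_of_real (exp y powr \<nu> * f (exp y)))"
  shows "integrable lborel g"
    and "mellin_datum f (Complex \<nu> \<tau>) = (LBINT y. g y * exp (\<i> * of_real (\<tau> * y)))"
proof -
  have eq: "exp y *\<^sub>R (of_real (exp y) powr (Complex \<nu> \<sigma> - 1) * complex_of_real (f (exp y)))
      = g y * exp (\<i> * of_real (\<sigma> * y))" for y \<sigma>
  proof -
    have 1: "of_real (exp y) powr (Complex \<nu> \<sigma> - 1) = exp ((Complex \<nu> \<sigma> - 1) * of_real y)"
      using cpow_pos[of "exp y" "Complex \<nu> \<sigma> - 1"] by simp
    have 2: "exp y powr \<nu> = exp (\<nu> * y)" by (simp add: powr_def)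
    have "complex_of_real (exp y) * of_real (exp y) powr (Complex \<nu> \<sigma> - 1)
        = exp (of_real y + (Complex \<nu> \<sigma> - 1) * of_real y)"
      by (simp only: 1 exp_add exp_of_real)
    also have "of_real y + (Complex \<nu> \<sigma> - 1) * of_real y = of_real (\<nu> * y) + \<i> * of_real (\<sigma> * y)"
      by (simp add: Complex_eq algebra_simps)
    also have "exp (of_real (\<nu> * y) + \<i> * of_real (\<sigma> * y)) = of_real (exp y powr \<nu>) * exp (\<i> * of_real (\<sigma> * y))"
      unfolding 2 exp_add exp_of_real ..
    finally show ?thesis by (simp add: g_def scaleR_conv_of_real mult_ac)
  qed
  have int': "integrable pos_lborel (\<lambda>x. of_real x powr (Complex \<nu> \<sigma> - 1) * complex_of_real (f x))" for \<sigma>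
    using integrable_mellin[of "Complex \<nu> \<sigma>" f] int by simp
  show "integrable lborel g"
    using exp_substitution(1)[OF int'[of 0]] unfolding eq by simp
  show "mellin_datum f (Complex \<nu> \<tau>) = (LBINT y. g y * exp (\<i> * of_real (\<tau> * y)))"
    using exp_substitution(2)[OF int'[of \<tau>]] unfolding eq mellin_datum_eq by simp
qed

theorem mellin_inversion:
  assumes cont: "continuous_on {0<..} f"
    and int: "integrable pos_lborel (\<lambda>x. x powr (\<nu> - 1) * f x)"
    and bdd: "\<And>x. x > 0 \<Longrightarrow> \<bar>f x\<bar> \<le> B * x powr (- \<nu>)"
    and F: "integrable lborel (\<lambda>\<tau>. mellin_datum f (Complex \<nu> \<tau>))"
    and x: "x > 0"
  shows "complex_of_real (f x) = 1 / (2 * of_real pi) *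
    (LBINT \<tau>. mellin_datum f (Complex \<nu> \<tau>) * of_real x powr (- Complex \<nu> \<tau>))"
proof -
  let ?g = "\<lambda>y. complex_of_real (exp y powr \<nu> * f (exp y))"
  note sub = mellin_substitution[OF int]
  have "?g (ln x) = 1 / (2 * of_real pi) *
    (LBINT \<tau>. (LBINT y. ?g y * exp (\<i> * of_real (\<tau> * y))) * exp (- \<i> * of_real (\<tau> * ln x)))"
  proof (rule fourier_inversion)
    show "integrable lborel ?g" by (rule sub)
    show "integrable lborel (\<lambda>\<tau>. LBINT y. ?g y * exp (\<i> * of_real (\<tau> * y)))"
      using F unfolding sub(2) .
    show "norm (?g y) \<le> B" for y
    proof -
      have "norm (?g y) = exp y powr \<nu> * \<bar>f (exp y)\<bar>"
        unfolding norm_of_real by (simp add: abs_mult)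
      also have "\<dots> \<le> exp y powr \<nu> * (B * exp y powr (- \<nu>))" by (intro mult_left_mono bdd) auto
      also have "\<dots> = B" by (simp add: powr_minus field_simps)
      finally show ?thesis .
    qed
    have "isCont f x" using cont x by (simp add: continuous_on_eq_continuous_at)
    then show "isCont ?g (ln x)"
      using x by (intro continuous_intros isCont_o2[OF isCont_exp]) (auto simp: powr_def)
  qed
  also have "(LBINT \<tau>. (LBINT y. ?g y * exp (\<i> * of_real (\<tau> * y))) * exp (- \<i> * of_real (\<tau> * ln x)))
     = (LBINT \<tau>. of_real (x powr \<nu>) * (mellin_datum f (Complex \<nu> \<tau>) * of_real x powr (- Complex \<nu> \<tau>)))"
  proof (rule Bochner_Integration.integral_cong[OF refl])
    fix \<tau>
    have 1: "x powr \<nu> = exp (\<nu> * ln x)" using x by (simp add: powr_def)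
    have "of_real (x powr \<nu>) * of_real x powr (- Complex \<nu> \<tau>)
        = exp (of_real (\<nu> * ln x) + - Complex \<nu> \<tau> * of_real (ln x))"
      unfolding 1 cpow_pos[OF x] exp_add exp_of_real ..
    also have "of_real (\<nu> * ln x) + - Complex \<nu> \<tau> * of_real (ln x) = - \<i> * of_real (\<tau> * ln x)"
      by (simp add: Complex_eq algebra_simps)
    finally have "of_real (x powr \<nu>) * of_real x powr (- Complex \<nu> \<tau>) = exp (- \<i> * of_real (\<tau> * ln x))" .
    then show "(LBINT y. ?g y * exp (\<i> * of_real (\<tau> * y))) * exp (- \<i> * of_real (\<tau> * ln x)) =
       of_real (x powr \<nu>) * (mellin_datum f (Complex \<nu> \<tau>) * of_real x powr (- Complex \<nu> \<tau>))"
      unfolding sub(2)[symmetric] by (simp add: mult_ac)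
  qed
  finally have "complex_of_real (x powr \<nu>) * complex_of_real (f x) = complex_of_real (x powr \<nu>) *
      (1 / (2 * of_real pi) *
        (LBINT \<tau>. mellin_datum f (Complex \<nu> \<tau>) * of_real x powr (- Complex \<nu> \<tau>)))"
    using x by simp
  moreover have "complex_of_real (x powr \<nu>) \<noteq> 0" using x by simp
  ultimately show ?thesis by (metis mult_left_cancel)
qed

lemma integrable_inverse_1_plus_square_lborel: "integrable lborel (\<lambda>x::real. M / (1 + x\<^sup>2))"
  using integrable_mult_right[OF integrable_inverse_1_plus_square[unfolded set_integrable_def], of M]
  by (simp add: inverse_eq_divide)

text \<open>The two relations produced by integration by parts give \<open>s (s+1) F(s) = F''(s+2)\<close>, writing
  \<open>F''\<close> for the transform of \<open>f''\<close>; on \<open>Re s > 1\<close> the factor \<open>s (s+1)\<close> is at least \<open>1 + \<tau>\<^sup>2\<close> in modulus.\<close>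

lemma mellin_datum_decay:
  assumes \<nu>: "\<nu> > 1"
    and parts: "\<And>\<tau>. Complex \<nu> \<tau> * mellin_datum f (Complex \<nu> \<tau>) = - mellin_datum f' (Complex \<nu> \<tau> + 1)"
      "\<And>\<tau>. (Complex \<nu> \<tau> + 1) * mellin_datum f' (Complex \<nu> \<tau> + 1) = - mellin_datum f'' (Complex \<nu> \<tau> + 1 + 1)"
    and f'': "integrable pos_lborel (\<lambda>x. x powr (\<nu> + 1) * f'' x)"
  shows "norm (mellin_datum f (Complex \<nu> \<tau>)) \<le> (LINT x|pos_lborel. \<bar>x powr (\<nu> + 1) * f'' x\<bar>) / (1 + \<tau>\<^sup>2)"
proof -
  let ?s = "Complex \<nu> \<tau>" and ?M = "LINT x|pos_lborel. \<bar>x powr (\<nu> + 1) * f'' x\<bar>"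
  have "?s * (?s + 1) * mellin_datum f ?s = mellin_datum f'' (?s + 1 + 1)"
  proof -
    have "?s * (?s + 1) * mellin_datum f ?s = (?s + 1) * (?s * mellin_datum f ?s)" by (simp only: mult_ac)
    also have "\<dots> = - ((?s + 1) * mellin_datum f' (?s + 1))" unfolding parts(1) by simp
    also have "\<dots> = mellin_datum f'' (?s + 1 + 1)" unfolding parts(2) by simp
    finally show ?thesis .
  qed
  then have "norm ?s * norm (?s + 1) * norm (mellin_datum f ?s) = norm (mellin_datum f'' (?s + 1 + 1))"
    by (metis norm_mult)
  also have "\<dots> \<le> (LINT x|pos_lborel. norm (of_real x powr (?s + 1 + 1 - 1) * complex_of_real (f'' x)))"
    unfolding mellin_datum_eq by (rule integral_norm_bound)
  also have "\<dots> = ?M"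
    by (rule Bochner_Integration.integral_cong[OF refl]) (auto simp: norm_mult norm_cpow abs_mult add.commute)
  finally have 1: "norm ?s * norm (?s + 1) * norm (mellin_datum f ?s) \<le> ?M" .
  have "1 + \<tau>\<^sup>2 \<le> \<nu>\<^sup>2 + \<tau>\<^sup>2" using \<nu> one_le_power[of \<nu> 2] by simp
  also have "\<dots> = norm ?s * norm ?s" by (simp add: cmod_def)
  also have "\<dots> \<le> norm ?s * norm (?s + 1)"
    using \<nu> by (intro mult_left_mono) (auto simp: cmod_def)
  finally have "(1 + \<tau>\<^sup>2) * norm (mellin_datum f ?s) \<le> ?M"
    using 1 by (meson mult_right_mono norm_ge_zero order_trans)
  then show ?thesis by (simp add: field_simps add_pos_nonneg)
qed

lemma mellin_datum_measurable:
  assumes int: "integrable pos_lborel (\<lambda>x. x powr (\<nu> - 1) * f x)"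
  shows "(\<lambda>\<tau>. mellin_datum f (Complex \<nu> \<tau>)) \<in> borel_measurable borel"
proof -
  note [measurable] = borel_measurable_integrable[OF mellin_substitution(1)[OF int]]
  show ?thesis unfolding mellin_substitution(2)[OF int]
    by (rule lborel.borel_measurable_lebesgue_integral) measurable
qed

theorem mellin_unique:
  assumes int: "integrable pos_lborel (\<lambda>x. x powr (\<nu> - 1) * h x)"
    and zero: "\<And>\<tau>. mellin_datum h (Complex \<nu> \<tau>) = 0"
  shows "AE x in lborel. x > 0 \<longrightarrow> h x = 0"
proof -
  let ?k = "\<lambda>y. exp y powr \<nu> * h (exp y)"
  have "integrable lborel (\<lambda>y. complex_of_real (?k y))"
    using mellin_substitution(1)[OF int] .
  then have "integrable lborel ?k" using integrable_Re by fastforce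
  moreover have "(LBINT y. of_real (?k y) * exp (\<i> * of_real (\<tau> * y))) = 0" for \<tau>
    using mellin_substitution(2)[OF int, of \<tau>] zero by simp
  ultimately have ae: "AE y in lborel. ?k y = 0" by (rule fourier_unique)
  have int': "integrable pos_lborel (\<lambda>x. \<bar>x powr (\<nu> - 1) * h x\<bar>)" using int by simp
  have "complex_of_real (LINT x|pos_lborel. \<bar>x powr (\<nu> - 1) * h x\<bar>)
      = (LBINT y. exp y *\<^sub>R complex_of_real \<bar>exp y powr (\<nu> - 1) * h (exp y)\<bar>)"
    by (subst exp_substitution(2)) (use int' in auto)
  also have "\<dots> = (LBINT y::real. 0)"
  proof (rule integral_cong_AE)
    show "AE y in lborel. exp y *\<^sub>R complex_of_real \<bar>exp y powr (\<nu> - 1) * h (exp y)\<bar> = 0"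
      using ae by eventually_elim auto
    show "(\<lambda>y. exp y *\<^sub>R complex_of_real \<bar>exp y powr (\<nu> - 1) * h (exp y)\<bar>) \<in> borel_measurable lborel"
      by (rule borel_measurable_integrable, rule exp_substitution(1)) (use int' in auto)
  qed auto
  finally have "(LINT x|pos_lborel. \<bar>x powr (\<nu> - 1) * h x\<bar>) = 0" by simp
  then have "AE x in pos_lborel. \<bar>x powr (\<nu> - 1) * h x\<bar> = 0"
    using integral_nonneg_eq_0_iff_AE[OF int'] by auto
  then have "AE x in lborel. x > 0 \<longrightarrow> \<bar>x powr (\<nu> - 1) * h x\<bar> = 0" unfolding AE_pos_iff .
  then show ?thesis by eventually_elim auto
qed

lemma bounded_pos_half_line:
  fixes g :: "real \<Rightarrow> real"
  assumes cont: "continuous_on {0<..} g"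
    and lim0: "(g \<longlongrightarrow> 0) (at_right 0)" and lim_top: "(g \<longlongrightarrow> 0) at_top"
  obtains B where "\<And>x. x > 0 \<Longrightarrow> \<bar>g x\<bar> \<le> B"
proof -
  have "\<forall>\<^sub>F x in at_right 0. \<bar>g x\<bar> < 1"
    using order_tendstoD(2)[OF tendsto_rabs_zero[OF lim0]] by simp
  then obtain a where a: "a > 0" "\<And>x. 0 < x \<Longrightarrow> x < a \<Longrightarrow> \<bar>g x\<bar> < 1"
    unfolding eventually_at_right_field by auto
  have "\<forall>\<^sub>F x in at_top. \<bar>g x\<bar> < 1"
    using order_tendstoD(2)[OF tendsto_rabs_zero[OF lim_top]] by simp
  then obtain b where b: "\<And>x. x \<ge> b \<Longrightarrow> \<bar>g x\<bar> < 1"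
    unfolding eventually_at_top_linorder by auto
  have "compact (g ` {a..b})"
    by (intro compact_continuous_image continuous_on_subset[OF cont]) (use a in auto)
  then have "bounded (g ` {a..b})" by (rule compact_imp_bounded)
  then obtain c where c: "\<forall>x\<in>{a..b}. \<bar>g x\<bar> \<le> c"
    unfolding bounded_iff by auto
  show thesis
  proof (rule that[of "max 1 c"])
    fix x :: real assume "x > 0"
    then consider "x < a" | "x \<ge> b" | "x \<in> {a..b}" by fastforce
    then show "\<bar>g x\<bar> \<le> max 1 c"
      using a(2)[OF \<open>x > 0\<close>] b[of x] c by cases (auto intro: less_imp_le le_max_iff_disj[THEN iffD2])
  qed
qed

text \<open>For a twice differentiable function with the stated decay the transform is integrable along the
  vertical line, so inversion applies. The pointwise bound, obtained from the limits of
  \<open>x\<^sup>\<nu> f x\<close> at both ends, serves twice: in the inversion theorem and for the convergence of the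
  series in \<open>frag_semigroup\<close>.\<close>

theorem mellin_decay_and_inversion:
  fixes f f' f'' :: "real \<Rightarrow> real"
  assumes \<nu>: "\<nu> > 1"
    and f': "\<And>x. x > 0 \<Longrightarrow> (f has_real_derivative f' x) (at x)"
    and f'': "\<And>x. x > 0 \<Longrightarrow> (f' has_real_derivative f'' x) (at x)"
    and int: "integrable pos_lborel (\<lambda>x. x powr (\<nu> - 1) * f x)"
    and int': "set_integrable lborel {0<..} (\<lambda>x. \<bar>f' x\<bar> * x powr \<nu>)"
    and int'': "set_integrable lborel {0<..} (\<lambda>x. \<bar>f'' x\<bar> * x powr (1 + \<nu>))"
    and lim: "((\<lambda>x. x powr \<nu> * f x) \<longlongrightarrow> 0) (at_right 0)" "((\<lambda>x. x powr \<nu> * f x) \<longlongrightarrow> 0) at_top"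
    and lim': "((\<lambda>x. x powr (1 + \<nu>) * f' x) \<longlongrightarrow> 0) (at_right 0)"
      "((\<lambda>x. x powr (1 + \<nu>) * f' x) \<longlongrightarrow> 0) at_top"
  shows "integrable lborel (\<lambda>\<tau>. mellin_datum f (Complex \<nu> \<tau>))"
    and "x > 0 \<Longrightarrow> complex_of_real (f x) = 1 / (2 * of_real pi) *
      (LBINT \<tau>. mellin_datum f (Complex \<nu> \<tau>) * of_real x powr (- Complex \<nu> \<tau>))"
    and "\<exists>B. \<forall>x>0. \<bar>f x\<bar> \<le> B * x powr (- \<nu>)"
proof -
  have unabs: "integrable pos_lborel (\<lambda>x. x powr p * g x)"
    if "set_integrable lborel {0<..} (\<lambda>x. \<bar>g x\<bar> * x powr p)" "g \<in> borel_measurable pos_lborel" for g p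
  proof (rule Bochner_Integration.integrable_bound)
    show "integrable pos_lborel (\<lambda>x. \<bar>g x\<bar> * x powr p)" using that(1) by (simp add: set_integrable_pos_iff)
    show "(\<lambda>x. x powr p * g x) \<in> borel_measurable pos_lborel"
      by (intro borel_measurable_times that(2) borel_measurable_pos_lborelI) measurable
  qed (simp add: abs_mult mult.commute)
  have i': "integrable pos_lborel (\<lambda>x. x powr \<nu> * f' x)"
    by (rule unabs[OF int' measurable_differentiable_pos(2)[OF f']])
  have i'': "integrable pos_lborel (\<lambda>x. x powr (\<nu> + 1) * f'' x)"
    using unabs[OF int'' measurable_differentiable_pos(2)[OF f'']] by (simp add: add.commute)
  have parts: "Complex \<nu> \<tau> * mellin_datum f (Complex \<nu> \<tau>) = - mellin_datum f' (Complex \<nu> \<tau> + 1)"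
    "(Complex \<nu> \<tau> + 1) * mellin_datum f' (Complex \<nu> \<tau> + 1) = - mellin_datum f'' (Complex \<nu> \<tau> + 1 + 1)" for \<tau>
    using mellin_by_parts[of f f' "Complex \<nu> \<tau>"] mellin_by_parts[of f' f'' "Complex \<nu> \<tau> + 1"]
      f' f'' int i' i'' lim lim' by (simp_all add: add.commute)
  show F: "integrable lborel (\<lambda>\<tau>. mellin_datum f (Complex \<nu> \<tau>))"
  proof (rule Bochner_Integration.integrable_bound[OF integrable_inverse_1_plus_square_lborel])
    show "(\<lambda>\<tau>. mellin_datum f (Complex \<nu> \<tau>)) \<in> borel_measurable lborel"
      using mellin_datum_measurable[OF int] by simp
    show "AE \<tau> in lborel. norm (mellin_datum f (Complex \<nu> \<tau>))
        \<le> norm ((LINT x|pos_lborel. \<bar>x powr (\<nu> + 1) * f'' x\<bar>) / (1 + \<tau>\<^sup>2))"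
      unfolding real_norm_def
      using order_trans[OF mellin_datum_decay[OF \<nu> parts i''] abs_ge_self] by (intro AE_I2)
  qed
  have cont: "continuous_on {0<..} f"
    using f' by (auto intro!: continuous_at_imp_continuous_on DERIV_isCont)
  have "continuous_on {0<..} (\<lambda>x. x powr \<nu> * f x)"
    by (intro continuous_intros cont) auto
  from bounded_pos_half_line[OF this lim]
  obtain B where B: "\<And>x. x > 0 \<Longrightarrow> \<bar>x powr \<nu> * f x\<bar> \<le> B" by blast
  have B': "\<bar>f x\<bar> \<le> B * x powr (- \<nu>)" if "x > 0" for x
    using B[OF that] that by (simp add: abs_mult powr_minus field_simps)
  then show "\<exists>B. \<forall>x>0. \<bar>f x\<bar> \<le> B * x powr (- \<nu>)" by blast
  show "complex_of_real (f x) = 1 / (2 * of_real pi) *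
      (LBINT \<tau>. mellin_datum f (Complex \<nu> \<tau>) * of_real x powr (- Complex \<nu> \<tau>))" if "x > 0"
    by (rule mellin_inversion[OF cont int B' F that])
qed

section \<open>Mellin transforms on the weighted space\<close>

lemma mellin_datum_of_real:
  "mellin_datum f (complex_of_real p) = of_real (LINT x|pos_lborel. x powr (p - 1) * f x)"
proof -
  have "mellin_datum f (complex_of_real p) = (LINT x|pos_lborel. complex_of_real (x powr (p - 1) * f x))"
    unfolding mellin_datum_eq
    by (rule Bochner_Integration.integral_cong) (auto simp flip: powr_of_real)
  then show ?thesis unfolding integral_complex_of_real .
qed

lemma powr_weight_le:
  fixes x p :: real
  assumes "x > 0" "0 \<le> p" "p \<le> 1"
  shows "x powr p \<le> 1 + x"
proof (cases "x \<le> 1")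
  case True
  then have "x powr p \<le> 1" using assms powr_mono2[of p x 1] by simp
  then show ?thesis using assms by simp
next
  case False
  then have "x powr p \<le> x powr 1" using assms by (intro powr_mono) auto
  then show ?thesis using assms by simp
qed

lemma in_wL1_weighted:
  assumes f: "in_wL1 f" and p: "1 \<le> p" "p \<le> 2"
  shows "integrable pos_lborel (\<lambda>x. x powr (p - 1) * f x)"
proof -
  have i: "integrable pos_lborel (\<lambda>x. (1 + x) * f x)"
    using f by (simp add: in_wL1_def set_integrable_pos_iff)
  have "(\<lambda>x. 1 / (1 + x) * ((1 + x) * f x)) \<in> borel_measurable pos_lborel"
    by (intro borel_measurable_times borel_measurable_integrable[OF i] borel_measurable_pos_lborelI) measurable
  then have m: "f \<in> borel_measurable pos_lborel"
    by (rule measurable_cong[THEN iffD1, rotated]) (simp add: field_simps)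
  show ?thesis
  proof (rule Bochner_Integration.integrable_bound[OF i])
    show "(\<lambda>x. x powr (p - 1) * f x) \<in> borel_measurable pos_lborel"
      by (intro borel_measurable_times m borel_measurable_pos_lborelI) measurable
    show "AE x in pos_lborel. norm (x powr (p - 1) * f x) \<le> norm ((1 + x) * f x)"
    proof (rule AE_I2)
      fix x assume "x \<in> space pos_lborel"
      then have "x > 0" by simp
      then show "norm (x powr (p - 1) * f x) \<le> norm ((1 + x) * f x)"
        using powr_weight_le[of x "p - 1"] p by (simp add: abs_mult mult_right_mono)
    qed
  qed
qed

text \<open>For \<open>1 \<le> Re s \<le> 2\<close> the weight \<open>x\<^bsup>Re s - 1\<^esup>\<close> is dominated by \<open>1 + x\<close>, so the Mellin transform
  at \<open>s\<close> is a continuous linear functional on the space in which the solution moves.\<close>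

lemma norm_mellin_datum_le:
  assumes f: "in_wL1 f" and s: "1 \<le> Re s" "Re s \<le> 2"
  shows "norm (mellin_datum f s) \<le> wL1_norm f"
proof -
  have i: "integrable pos_lborel (\<lambda>x. (1 + x) * f x)"
    using f by (simp add: in_wL1_def set_integrable_pos_iff)
  have "integrable pos_lborel (\<lambda>x. \<bar>(1 + x) * f x\<bar>)" using i by (rule integrable_abs)
  then have i': "integrable pos_lborel (\<lambda>x. (1 + x) * \<bar>f x\<bar>)"
    by (rule Bochner_Integration.integrable_cong[OF refl, THEN iffD1, rotated]) (simp add: abs_mult)
  have "norm (mellin_datum f s) \<le> (LINT x|pos_lborel. norm (of_real x powr (s - 1) * complex_of_real (f x)))"
    unfolding mellin_datum_eq by (rule integral_norm_bound)
  also have "\<dots> \<le> (LINT x|pos_lborel. (1 + x) * \<bar>f x\<bar>)"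
  proof (rule integral_mono[OF integrable_norm[OF integrable_mellin] i'])
    show "integrable pos_lborel (\<lambda>x. x powr (Re s - 1) * f x)" by (rule in_wL1_weighted[OF f s])
    fix x assume "x \<in> space pos_lborel"
    then show "norm (of_real x powr (s - 1) * complex_of_real (f x)) \<le> (1 + x) * \<bar>f x\<bar>"
      using powr_weight_le[of x "Re s - 1"] s by (auto simp: norm_mult norm_cpow intro!: mult_right_mono)
  qed
  finally show ?thesis unfolding wL1_norm_def set_integral_pos_eq .
qed

lemma in_wL1_lincomb:
  assumes "in_wL1 f" "in_wL1 g"
  shows "in_wL1 (\<lambda>x. a * f x + b * g x)"
proof -
  have "integrable pos_lborel (\<lambda>x. a * ((1 + x) * f x) + b * ((1 + x) * g x))"
    using assms by (intro Bochner_Integration.integrable_add integrable_mult_right)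
      (auto simp: in_wL1_def set_integrable_pos_iff)
  then show ?thesis unfolding in_wL1_def set_integrable_pos_iff by (simp only: algebra_simps)
qed

lemma mellin_datum_lincomb:
  assumes f: "integrable pos_lborel (\<lambda>x. x powr (Re s - 1) * f x)"
    and g: "integrable pos_lborel (\<lambda>x. x powr (Re s - 1) * g x)"
  shows "mellin_datum (\<lambda>x. a * f x + b * g x) s = of_real a * mellin_datum f s + of_real b * mellin_datum g s"
proof -
  have "mellin_datum (\<lambda>x. a * f x + b * g x) s = (LINT x|pos_lborel.
      of_real a * (of_real x powr (s - 1) * of_real (f x)) + of_real b * (of_real x powr (s - 1) * of_real (g x)))"
    unfolding mellin_datum_eq by (simp add: algebra_simps)
  then show ?thesis
    using integrable_mellin[OF f] integrable_mellin[OF g] by (simp add: mellin_datum_eq)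
qed

lemma weighted_integrable_of_mellin:
  assumes "integrable pos_lborel (\<lambda>x. of_real x powr (of_real p - 1) * complex_of_real (f x))"
  shows "integrable pos_lborel (\<lambda>x. x powr (p - 1) * f x)"
proof -
  have "integrable pos_lborel (\<lambda>x. Re (of_real x powr (of_real p - 1) * complex_of_real (f x)))"
    using assms by (rule integrable_Re)
  moreover have "Re (of_real x powr (of_real p - 1) * complex_of_real (f x)) = x powr (p - 1) * f x"
    if "x > 0" for x
    using that powr_of_real[of x "p - 1"] by simp
  ultimately show ?thesis
    by (rule Bochner_Integration.integrable_cong[OF refl, THEN iffD1, rotated]) simp
qed

lemma mellin_datum_cong_AE:
  assumes f: "integrable pos_lborel (\<lambda>x. x powr (Re s - 1) * f x)"
    and g: "integrable pos_lborel (\<lambda>x. x powr (Re s - 1) * g x)"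
    and ae: "AE x in lborel. x > 0 \<longrightarrow> f x = g x"
  shows "mellin_datum f s = mellin_datum g s"
  unfolding mellin_datum_eq
proof (rule integral_cong_AE)
  show "AE x in pos_lborel. of_real x powr (s - 1) * complex_of_real (f x) = of_real x powr (s - 1) * complex_of_real (g x)"
    using ae unfolding AE_pos_iff by eventually_elim auto
qed (use integrable_mellin[OF f] integrable_mellin[OF g] in auto)

section \<open>The gain operator\<close>

definition kernel_measure :: "real measure \<Rightarrow> real measure" where
  "kernel_measure k0 = restrict_space k0 {0<..1}"

text \<open>The operator on the right-hand side of the fragmentation equation: the rate at which
  fragments of size \<open>x\<close> are created.\<close>

definition gain :: "real measure \<Rightarrow> (real \<Rightarrow> real) \<Rightarrow> real \<Rightarrow> real" where
  "gain k0 f x = (LINT z:{0<..1}|k0. f (x / z) / z)"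

locale fragmentation =
  fixes k0 :: "real measure"
  assumes kernel: "fragmentation_kernel k0"
begin

lemma sets_k0: "sets k0 = sets borel"
  using kernel by (simp add: fragmentation_kernel_def)

lemma space_kernel_measure [simp]: "space (kernel_measure k0) = {0<..1}"
  using sets_eq_imp_space_eq[OF sets_k0] by (simp add: kernel_measure_def space_restrict_space)

lemma sets_kernel_measure [measurable_cong]:
  "sets (kernel_measure k0) = sets (restrict_space borel {0<..1})"
  unfolding kernel_measure_def by (rule sets_restrict_space_cong) (rule sets_k0)

lemma finite_kernel_measure: "finite_measure (kernel_measure k0)"
  unfolding kernel_measure_def
  by (rule finite_measure_restrict_space) (use kernel sets_k0 in \<open>auto simp: fragmentation_kernel_def\<close>)

lemma borel_measurable_kernel_measureI:
  "f \<in> borel_measurable borel \<Longrightarrow> f \<in> borel_measurable (kernel_measure k0)"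
  unfolding kernel_measure_def
  by (rule measurable_restrict_space1) (simp add: measurable_cong_sets[OF sets_k0 refl])

lemma set_integral_kernel_eq:
  fixes f :: "real \<Rightarrow> 'a::{banach, second_countable_topology}"
  shows "(LINT z:{0<..1}|k0. f z) = (LINT z|kernel_measure k0. f z)"
  unfolding set_lebesgue_integral_def kernel_measure_def
  by (subst integral_restrict_space) (auto simp: sets_k0)

lemma gain_eq: "gain k0 f x = (LINT z|kernel_measure k0. f (x / z) / z)"
  unfolding gain_def set_integral_kernel_eq ..

lemma mellin_kernel_complex_eq:
  "mellin_kernel k0 s = (LINT z|kernel_measure k0. complex_of_real z powr (s - 1))"
  unfolding mellin_kernel_def set_integral_kernel_eq ..

lemma mellin_kernel_real_eq:
  "mellin_kernel k0 p = (LINT z|kernel_measure k0. z powr (p - 1))"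
  unfolding mellin_kernel_def set_integral_kernel_eq by simp

lemma cpow_measurable_kernel [measurable]:
  "(\<lambda>z. complex_of_real z powr s) \<in> borel_measurable (kernel_measure k0)"
proof -
  have "(\<lambda>x. exp (s * of_real (ln x))) \<in> borel_measurable (kernel_measure k0)"
    by (intro borel_measurable_kernel_measureI) measurable
  then show ?thesis
    by (rule measurable_cong[THEN iffD1, rotated]) (auto simp: cpow_pos)
qed

lemma powr_le_1: "0 < z \<Longrightarrow> z \<le> 1 \<Longrightarrow> 0 \<le> p \<Longrightarrow> z powr p \<le> (1::real)"
  using powr_mono2[of p z 1] by simp

lemma integrable_kernel_powr:
  assumes "p \<ge> 1" shows "integrable (kernel_measure k0) (\<lambda>z. z powr (p - 1))"
proof (rule finite_measure.integrable_const_bound[OF finite_kernel_measure, of _ 1])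
  show "AE z in kernel_measure k0. norm (z powr (p - 1)) \<le> 1"
    using assms by (intro AE_I2) (auto intro!: powr_le_1)
  show "(\<lambda>z. z powr (p - 1)) \<in> borel_measurable (kernel_measure k0)"
    by (intro borel_measurable_kernel_measureI) measurable
qed

lemma mellin_kernel_nonneg: "mellin_kernel k0 (p::real) \<ge> 0"
  unfolding mellin_kernel_real_eq by (rule integral_nonneg_AE) auto

lemma norm_mellin_kernel_le: "norm (mellin_kernel k0 s) \<le> mellin_kernel k0 (Re s)"
proof -
  have "norm (mellin_kernel k0 s) \<le> (LINT z|kernel_measure k0. norm (complex_of_real z powr (s - 1)))"
    unfolding mellin_kernel_complex_eq by (rule integral_norm_bound)
  also have "\<dots> = mellin_kernel k0 (Re s)"
    unfolding mellin_kernel_real_eq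
    by (rule Bochner_Integration.integral_cong) (auto simp: norm_cpow)
  finally show ?thesis .
qed

lemma mellin_kernel_of_real: "mellin_kernel k0 (complex_of_real p) = of_real (mellin_kernel k0 p)"
proof -
  have "mellin_kernel k0 (complex_of_real p) = (LINT z|kernel_measure k0. complex_of_real (z powr (p - 1)))"
    unfolding mellin_kernel_complex_eq
    by (rule Bochner_Integration.integral_cong) (auto simp flip: powr_of_real)
  then show ?thesis unfolding mellin_kernel_real_eq by simp
qed

lemma mellin_kernel_antimono:
  fixes p q :: real
  assumes "1 \<le> p" "p \<le> q"
  shows "mellin_kernel k0 q \<le> mellin_kernel k0 p"
  unfolding mellin_kernel_real_eq
  by (intro integral_mono integrable_kernel_powr) (use assms in \<open>auto intro: powr_mono'\<close>)

lemma mellin_kernel_measurable: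
  "(\<lambda>\<tau>. mellin_kernel k0 (Complex \<nu> \<tau>)) \<in> borel_measurable borel"
proof -
  interpret finite_measure "kernel_measure k0" by (rule finite_kernel_measure)
  have eq: "mellin_kernel k0 (Complex \<nu> \<tau>) =
      (LINT z|kernel_measure k0. exp ((of_real \<nu> + \<i> * of_real \<tau> - 1) * of_real (ln z)))" for \<tau>
    unfolding mellin_kernel_complex_eq
    by (rule Bochner_Integration.integral_cong) (auto simp: cpow_pos Complex_eq)
  have [measurable]: "(\<lambda>z. ln z) \<in> borel_measurable (kernel_measure k0)"
    by (intro borel_measurable_kernel_measureI) measurable
  show ?thesis unfolding eq by (rule borel_measurable_lebesgue_integral) measurable
qed

lemma quotient_measurable:
  "(\<lambda>(x, z). x / z) \<in> pos_lborel \<Otimes>\<^sub>M kernel_measure k0 \<rightarrow>\<^sub>M pos_lborel"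
proof -
  have [measurable]: "(\<lambda>z. z) \<in> borel_measurable (kernel_measure k0)"
      "(\<lambda>x. x) \<in> borel_measurable pos_lborel"
    by (auto intro: borel_measurable_kernel_measureI borel_measurable_pos_lborelI)
  have "(\<lambda>(x, z). x / z) \<in> pos_lborel \<Otimes>\<^sub>M kernel_measure k0 \<rightarrow>\<^sub>M restrict_space borel {0<..}"
    by (rule measurable_restrict_space2) (auto simp: space_pair_measure)
  then show ?thesis by measurable
qed

lemma gain_integrand_measurable:
  assumes [measurable]: "f \<in> borel_measurable pos_lborel"
  shows "(\<lambda>(x, z). f (x / z) / z) \<in> borel_measurable (pos_lborel \<Otimes>\<^sub>M kernel_measure k0)"
proof -
  have [measurable]: "(\<lambda>z. z) \<in> borel_measurable (kernel_measure k0)"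
    by (auto intro: borel_measurable_kernel_measureI)
  have [measurable]: "(\<lambda>(x, z). f (x / z)) \<in> borel_measurable (pos_lborel \<Otimes>\<^sub>M kernel_measure k0)"
    using measurable_compose[OF quotient_measurable assms] by (simp add: split_beta)
  show ?thesis by measurable
qed

lemma gain_measurable:
  assumes "f \<in> borel_measurable pos_lborel"
  shows "gain k0 f \<in> borel_measurable pos_lborel"
proof -
  interpret finite_measure "kernel_measure k0" by (rule finite_kernel_measure)
  show ?thesis unfolding gain_eq[abs_def]
    by (rule borel_measurable_lebesgue_integral) (rule gain_integrand_measurable[OF assms])
qed

lemma gain_nonneg:
  assumes "\<And>x. x > 0 \<Longrightarrow> f x \<ge> 0" "x > 0"
  shows "gain k0 f x \<ge> 0"
  unfolding gain_eq by (rule integral_nonneg_AE) (use assms in \<open>auto intro!: AE_I2\<close>)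

text \<open>Powers are eigenfunctions of the gain operator, and its value at \<open>x\<close> involves only arguments
  \<open>x / z \<ge> x\<close>; hence an approximation by a power on a half-line \<open>[a, \<infinity>)\<close> is preserved. Two
  instances matter: \<open>a = 1\<close> for the asymptotics, and \<open>a = 0\<close> with \<open>c = 0\<close> for the global bound that
  makes the series converge.\<close>

lemma gain_power_approx:
  assumes f: "f \<in> borel_measurable pos_lborel"
    and pq: "p \<ge> 1" "q \<ge> 1"
    and approx: "\<And>x. x > 0 \<Longrightarrow> x \<ge> a \<Longrightarrow> \<bar>f x - c * x powr (- q)\<bar> \<le> C * x powr (- p)"
    and x: "x > 0" "x \<ge> a"
  shows "\<bar>gain k0 f x - c * mellin_kernel k0 q * x powr (- q)\<bar> \<le> C * mellin_kernel k0 p * x powr (- p)"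
proof -
  have scale: "(x / z) powr (- b) / z = x powr (- b) * z powr (b - 1)" if "z \<in> {0<..1}" for z b
    using that x(1) by (simp add: powr_divide powr_minus powr_diff divide_simps)
  have le: "\<bar>f (x / z) / z - c * x powr (- q) * z powr (q - 1)\<bar> \<le> C * x powr (- p) * z powr (p - 1)"
    if z: "z \<in> {0<..1}" for z
  proof -
    have "x * z \<le> x * 1" using z x(1) by (intro mult_left_mono) auto
    then have xz: "x / z \<ge> x" "x / z > 0" using z x(1) by (auto simp: field_simps)
    have "\<bar>f (x / z) / z - c * x powr (- q) * z powr (q - 1)\<bar> = \<bar>f (x / z) / z - c * ((x / z) powr (- q) / z)\<bar>"
      unfolding scale[OF z] by (simp add: mult.assoc)
    also have "\<dots> = \<bar>f (x / z) - c * (x / z) powr (- q)\<bar> / z"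
      using z by (simp add: diff_divide_distrib[symmetric] abs_divide)
    also have "\<dots> \<le> C * (x / z) powr (- p) / z"
      using z xz x(2) by (intro divide_right_mono approx) auto
    also have "\<dots> = C * x powr (- p) * z powr (p - 1)"
      by (simp only: times_divide_eq_right[symmetric] mult.assoc scale[OF z])
    finally show ?thesis .
  qed
  have iq: "integrable (kernel_measure k0) (\<lambda>z. c * x powr (- q) * z powr (q - 1))"
    and ip: "integrable (kernel_measure k0) (\<lambda>z. C * x powr (- p) * z powr (p - 1))"
    using integrable_kernel_powr pq by auto
  have [measurable]: "(\<lambda>z. f (x / z) / z) \<in> borel_measurable (kernel_measure k0)"
    using measurable_compose[OF measurable_Pair1' gain_integrand_measurable[OF f], of x] x by simp
  have "integrable (kernel_measure k0) (\<lambda>z. f (x / z) / z - c * x powr (- q) * z powr (q - 1))"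
  proof (rule Bochner_Integration.integrable_bound[OF ip])
    show "AE z in kernel_measure k0. norm (f (x / z) / z - c * x powr (- q) * z powr (q - 1))
        \<le> norm (C * x powr (- p) * z powr (p - 1))"
      unfolding real_norm_def using order_trans[OF le abs_ge_self] by (intro AE_I2) simp
  qed (use iq in measurable)
  from Bochner_Integration.integrable_add[OF this iq]
  have if': "integrable (kernel_measure k0) (\<lambda>z. f (x / z) / z)" by simp
  have eq: "gain k0 f x - c * mellin_kernel k0 q * x powr (- q) =
     (LINT z|kernel_measure k0. f (x / z) / z - c * x powr (- q) * z powr (q - 1))"
    unfolding gain_eq mellin_kernel_real_eq using if' iq by simp
  have "\<bar>gain k0 f x - c * mellin_kernel k0 q * x powr (- q)\<bar>
      \<le> (LINT z|kernel_measure k0. \<bar>f (x / z) / z - c * x powr (- q) * z powr (q - 1)\<bar>)"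
    unfolding eq by (rule integral_abs_bound)
  also have "\<dots> \<le> (LINT z|kernel_measure k0. C * x powr (- p) * z powr (p - 1))"
    by (rule integral_mono) (use if' iq ip le in auto)
  also have "\<dots> = C * mellin_kernel k0 p * x powr (- p)"
    unfolding mellin_kernel_real_eq by simp
  finally show ?thesis .
qed

text \<open>The gain operator is a multiplicative convolution with \<open>k\<^sub>0\<close>, so by Fubini and the scaling
  \<open>x = z y\<close> its Mellin transform is a product. The condition \<open>Re s \<ge> 1\<close> makes \<open>z\<^bsup>s-1\<^esup>\<close> bounded
  on \<open>(0,1]\<close>.\<close>

theorem gain_mellin:
  assumes int: "integrable pos_lborel (\<lambda>x. x powr (Re s - 1) * f x)" and s: "Re s \<ge> 1"
  shows "integrable pos_lborel (\<lambda>x. of_real x powr (s - 1) * complex_of_real (gain k0 f x))"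
    and "mellin_datum (gain k0 f) s = mellin_kernel k0 s * mellin_datum f s"
proof -
  let ?\<kappa> = "kernel_measure k0"
  interpret K: finite_measure ?\<kappa> by (rule finite_kernel_measure)
  interpret P: sigma_finite_measure pos_lborel by (rule sigma_finite_pos_lborel)
  interpret KP: pair_sigma_finite ?\<kappa> pos_lborel ..
  define g where "g = (\<lambda>y. of_real y powr (s - 1) * complex_of_real (f y))"
  define H where "H = (\<lambda>z x. of_real x powr (s - 1) * complex_of_real (f (x / z) / z))"
  have g: "integrable pos_lborel g" unfolding g_def by (rule integrable_mellin[OF int])
  have f: "f \<in> borel_measurable pos_lborel" by (rule measurable_of_weighted[OF int])
  have H: "H z x = of_real z powr (s - 1) / of_real z * g (x / z)" if "z \<in> {0<..1}" "x > 0" for z x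
  proof -
    have "of_real x powr (s - 1) = of_real (z * (x / z)) powr (s - 1)" using that by simp
    also have "\<dots> = of_real z powr (s - 1) * of_real (x / z) powr (s - 1)"
      using that by (intro cpow_mult) auto
    finally show ?thesis unfolding H_def g_def by simp
  qed
  have Hint: "integrable pos_lborel (H z)"
    and Hval: "(LINT x|pos_lborel. H z x) = of_real z powr (s - 1) * mellin_datum f s"
    and Hnorm: "(LINT x|pos_lborel. norm (H z x)) = z powr (Re s - 1) * (LINT x|pos_lborel. norm (g x))"
    if z: "z \<in> {0<..1}" for z
  proof -
    have z0: "z > 0" using z by simp
    have "integrable pos_lborel (\<lambda>x. of_real z powr (s - 1) / of_real z * g (x / z))"
      using pos_scaling(1)[OF g z0] by simp
    then show "integrable pos_lborel (H z)"
      by (rule Bochner_Integration.integrable_cong[OF refl, THEN iffD1, rotated]) (simp add: H[OF z])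
    have "(LINT x|pos_lborel. H z x) = (LINT x|pos_lborel. of_real z powr (s - 1) / of_real z * g (x / z))"
      by (rule Bochner_Integration.integral_cong) (auto simp: H[OF z])
    also have "\<dots> = of_real z powr (s - 1) / of_real z * (z *\<^sub>R (LINT x|pos_lborel. g x))"
      using pos_scaling(2)[OF g z0] by (simp add: scaleR_conv_of_real)
    also have "\<dots> = of_real z powr (s - 1) * mellin_datum f s"
      using z0 by (simp add: scaleR_conv_of_real mellin_datum_eq g_def)
    finally show "(LINT x|pos_lborel. H z x) = of_real z powr (s - 1) * mellin_datum f s" .
    have "(LINT x|pos_lborel. norm (H z x)) = (LINT x|pos_lborel. z powr (Re s - 1) / z * norm (g (x / z)))"
      using z0 by (intro Bochner_Integration.integral_cong) (auto simp: H[OF z] norm_mult norm_divide norm_cpow)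
    also have "\<dots> = z powr (Re s - 1) / z * (z *\<^sub>R (LINT x|pos_lborel. norm (g x)))"
      using pos_scaling(2)[OF integrable_norm[OF g] z0] by simp
    finally show "(LINT x|pos_lborel. norm (H z x)) = z powr (Re s - 1) * (LINT x|pos_lborel. norm (g x))"
      using z0 by simp
  qed
  have "(\<lambda>(z, x). f (x / z) / z) \<in> borel_measurable (?\<kappa> \<Otimes>\<^sub>M pos_lborel)"
    using measurable_compose[OF measurable_pair_swap' gain_integrand_measurable[OF f]]
    by (simp add: split_beta)
  then have Hmeas: "case_prod H \<in> borel_measurable (?\<kappa> \<Otimes>\<^sub>M pos_lborel)"
    unfolding H_def by measurable
  have "integrable (?\<kappa> \<Otimes>\<^sub>M pos_lborel) (case_prod H)"
  proof (rule KP.Fubini_integrable[OF Hmeas])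
    have "integrable ?\<kappa> (\<lambda>z. z powr (Re s - 1) * (LINT x|pos_lborel. norm (g x)))"
      using integrable_kernel_powr[OF s] by simp
    then show "integrable ?\<kappa> (\<lambda>z. LINT x|pos_lborel. norm (case (z, x) of (z, x) \<Rightarrow> H z x))"
      by (rule Bochner_Integration.integrable_cong[OF refl, THEN iffD1, rotated]) (simp add: Hnorm)
    show "AE z in ?\<kappa>. integrable pos_lborel (\<lambda>x. case (z, x) of (z, x) \<Rightarrow> H z x)"
      by (rule AE_I2) (simp add: Hint)
  qed
  note Fub = KP.integrable_snd[OF this] KP.Fubini_integral[OF this]
  have Hgain: "(LINT z|?\<kappa>. H z x) = of_real x powr (s - 1) * complex_of_real (gain k0 f x)" for x
    unfolding H_def gain_eq integral_mult_right_zero integral_complex_of_real ..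
  show "integrable pos_lborel (\<lambda>x. of_real x powr (s - 1) * complex_of_real (gain k0 f x))"
    using Fub(1) unfolding Hgain .
  have "mellin_datum (gain k0 f) s = (LINT z|?\<kappa>. LINT x|pos_lborel. H z x)"
    using Fub(2) unfolding Hgain mellin_datum_eq .
  also have "\<dots> = (LINT z|?\<kappa>. of_real z powr (s - 1) * mellin_datum f s)"
    by (rule Bochner_Integration.integral_cong) (auto simp: Hval)
  also have "\<dots> = mellin_kernel k0 s * mellin_datum f s"
    unfolding mellin_kernel_complex_eq by simp
  finally show "mellin_datum (gain k0 f) s = mellin_kernel k0 s * mellin_datum f s" .
qed

text \<open>Counterpart of \<open>gain_mellin\<close> for inverse Mellin integrals: the gain operator acts on
  \<open>x\<^bsup>-s\<^esup>\<close> as multiplication by \<open>K(s)\<close>, and Fubini moves it under the integral sign. The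
  identity holds at every \<open>x > 0\<close>, not just almost everywhere.\<close>

lemma gain_inverse_mellin:
  assumes G: "integrable lborel G" and \<nu>: "\<nu> \<ge> 1" and x: "x > 0"
    and f: "\<And>x. x > 0 \<Longrightarrow> complex_of_real (f x) =
      1 / (2 * of_real pi) * (LBINT \<tau>. G \<tau> * of_real x powr (- Complex \<nu> \<tau>))"
  shows "integrable lborel (\<lambda>\<tau>. G \<tau> * mellin_kernel k0 (Complex \<nu> \<tau>))"
    and "complex_of_real (gain k0 f x) = 1 / (2 * of_real pi) *
      (LBINT \<tau>. G \<tau> * mellin_kernel k0 (Complex \<nu> \<tau>) * of_real x powr (- Complex \<nu> \<tau>))"
proof -
  let ?\<kappa> = "kernel_measure k0"
  interpret K: finite_measure ?\<kappa> by (rule finite_kernel_measure)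
  interpret KL: pair_sigma_finite ?\<kappa> lborel ..
  note [measurable] = borel_measurable_integrable[OF G] mellin_kernel_measurable[of \<nu>]
  show "integrable lborel (\<lambda>\<tau>. G \<tau> * mellin_kernel k0 (Complex \<nu> \<tau>))"
  proof (rule Bochner_Integration.integrable_bound)
    show "integrable lborel (\<lambda>\<tau>. mellin_kernel k0 \<nu> * norm (G \<tau>))" using G by simp
    show "AE \<tau> in lborel. norm (G \<tau> * mellin_kernel k0 (Complex \<nu> \<tau>)) \<le> norm (mellin_kernel k0 \<nu> * norm (G \<tau>))"
    proof (rule AE_I2)
      fix \<tau>
      show "norm (G \<tau> * mellin_kernel k0 (Complex \<nu> \<tau>)) \<le> norm (mellin_kernel k0 \<nu> * norm (G \<tau>))"
        using mult_left_mono[OF norm_mellin_kernel_le[of "Complex \<nu> \<tau>"] norm_ge_zero[of "G \<tau>"]]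
          mellin_kernel_nonneg[of \<nu>] by (simp add: norm_mult abs_mult mult.commute)
    qed
  qed measurable
  define H where "H = (\<lambda>z \<tau>. G \<tau> * of_real x powr (- Complex \<nu> \<tau>) * of_real z powr (Complex \<nu> \<tau> - 1))"
  have Hz: "H z \<tau> = G \<tau> * of_real (x / z) powr (- Complex \<nu> \<tau>) / of_real z" if "z \<in> {0<..1}" for z \<tau>
  proof -
    have "of_real x powr (- Complex \<nu> \<tau>) = of_real ((x / z) * z) powr (- Complex \<nu> \<tau>)" using that by simp
    also have "\<dots> = of_real (x / z) powr (- Complex \<nu> \<tau>) * of_real z powr (- Complex \<nu> \<tau>)"
      using that x by (intro cpow_mult) auto
    finally have "H z \<tau> = G \<tau> * of_real (x / z) powr (- Complex \<nu> \<tau>) *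
       (of_real z powr (- Complex \<nu> \<tau>) * of_real z powr (Complex \<nu> \<tau> - 1))"
      unfolding H_def by (simp only: mult_ac)
    also have "of_real z powr (- Complex \<nu> \<tau>) * of_real z powr (Complex \<nu> \<tau> - 1) = complex_of_real z powr (- 1)"
      unfolding cpow_add by simp
    also have "\<dots> = 1 / of_real z" using that by (simp add: powr_minus field_simps)
    finally show ?thesis by simp
  qed
  have Hnorm: "norm (H z \<tau>) = x powr (- \<nu>) * z powr (\<nu> - 1) * norm (G \<tau>)" if "z \<in> {0<..1}" for z \<tau>
    using that x by (simp add: H_def norm_mult norm_cpow mult_ac)
  have Hmeas: "case_prod H \<in> borel_measurable (?\<kappa> \<Otimes>\<^sub>M lborel)"
  proof -
    have [measurable]: "(\<lambda>z. ln z) \<in> borel_measurable ?\<kappa>"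
      by (intro borel_measurable_kernel_measureI) measurable
    have "(\<lambda>(z, \<tau>). G \<tau> * exp (- (of_real \<nu> + \<i> * of_real \<tau>) * of_real (ln x)) *
         exp ((of_real \<nu> + \<i> * of_real \<tau> - 1) * of_real (ln z))) \<in> borel_measurable (?\<kappa> \<Otimes>\<^sub>M lborel)"
      by measurable
    then show ?thesis
      by (rule measurable_cong[THEN iffD1, rotated])
         (use x in \<open>auto simp: space_pair_measure H_def cpow_pos Complex_eq\<close>)
  qed
  have "integrable (?\<kappa> \<Otimes>\<^sub>M lborel) (case_prod H)"
  proof (rule KL.Fubini_integrable[OF Hmeas])
    have "integrable ?\<kappa> (\<lambda>z. x powr (- \<nu>) * z powr (\<nu> - 1) * (LBINT \<tau>. norm (G \<tau>)))"
      using integrable_kernel_powr[OF \<nu>] by simp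
    then show "integrable ?\<kappa> (\<lambda>z. LBINT \<tau>. norm (case (z, \<tau>) of (z, \<tau>) \<Rightarrow> H z \<tau>))"
      by (rule Bochner_Integration.integrable_cong[OF refl, THEN iffD1, rotated]) (simp add: Hnorm)
    show "AE z in ?\<kappa>. integrable lborel (\<lambda>\<tau>. case (z, \<tau>) of (z, \<tau>) \<Rightarrow> H z \<tau>)"
    proof (rule AE_I2)
      fix z assume z: "z \<in> space ?\<kappa>"
      then have z': "z \<in> {0<..1}" by simp
      have m: "H z \<in> borel_measurable lborel"
        using measurable_compose[OF measurable_Pair1'[OF z] Hmeas] by simp
      have i: "integrable lborel (\<lambda>\<tau>. x powr (- \<nu>) * z powr (\<nu> - 1) * norm (G \<tau>))" using G by simp
      have "integrable lborel (H z)"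
        by (rule Bochner_Integration.integrable_bound[OF i m]) (simp add: Hnorm[OF z'])
      then show "integrable lborel (\<lambda>\<tau>. case (z, \<tau>) of (z, \<tau>) \<Rightarrow> H z \<tau>)" by simp
    qed
  qed
  from KL.Fubini_integral[OF this]
  have Fub: "(LBINT \<tau>. (LINT z|?\<kappa>. H z \<tau>)) = (LINT z|?\<kappa>. (LBINT \<tau>. H z \<tau>))" .
  have "complex_of_real (gain k0 f x) = (LINT z|?\<kappa>. complex_of_real (f (x / z) / z))"
    unfolding gain_eq integral_complex_of_real ..
  also have "\<dots> = (LINT z|?\<kappa>. 1 / (2 * of_real pi) * (LBINT \<tau>. H z \<tau>))"
  proof (rule Bochner_Integration.integral_cong[OF refl])
    fix z assume "z \<in> space ?\<kappa>"
    then have z: "z \<in> {0<..1}" by simp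
    have "complex_of_real (f (x / z) / z) = 1 / (2 * of_real pi) *
        (LBINT \<tau>. G \<tau> * of_real (x / z) powr (- Complex \<nu> \<tau>)) / of_real z"
      using f[of "x / z"] z x by (simp del: of_real_divide add: of_real_divide[of "f (x / z)"])
    also have "\<dots> = 1 / (2 * of_real pi) * (LBINT \<tau>. H z \<tau>)"
      unfolding Hz[OF z] integral_divide_zero by simp
    finally show "complex_of_real (f (x / z) / z) = 1 / (2 * of_real pi) * (LBINT \<tau>. H z \<tau>)" .
  qed
  also have "\<dots> = 1 / (2 * of_real pi) * (LBINT \<tau>. (LINT z|?\<kappa>. H z \<tau>))"
    unfolding integral_mult_right_zero Fub ..
  also have "(\<lambda>\<tau>. LINT z|?\<kappa>. H z \<tau>) =
      (\<lambda>\<tau>. G \<tau> * mellin_kernel k0 (Complex \<nu> \<tau>) * of_real x powr (- Complex \<nu> \<tau>))"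
  proof
    fix \<tau>
    have "(LINT z|?\<kappa>. H z \<tau>) = G \<tau> * of_real x powr (- Complex \<nu> \<tau>) * mellin_kernel k0 (Complex \<nu> \<tau>)"
      unfolding H_def mellin_kernel_complex_eq integral_mult_right_zero ..
    then show "(LINT z|?\<kappa>. H z \<tau>) = G \<tau> * mellin_kernel k0 (Complex \<nu> \<tau>) * of_real x powr (- Complex \<nu> \<tau>)"
      by (simp only: mult_ac)
  qed
  finally show "complex_of_real (gain k0 f x) = 1 / (2 * of_real pi) *
      (LBINT \<tau>. G \<tau> * mellin_kernel k0 (Complex \<nu> \<tau>) * of_real x powr (- Complex \<nu> \<tau>))" .
qed

end

section \<open>The fragmentation semigroup\<close>

text \<open>The value at \<open>f\<close> of the operator \<open>exp (t (T - 1))\<close>, where \<open>T\<close> is the gain operator. It is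
  defined pointwise, so that it has a value at every \<open>x\<close> and not merely a class in \<open>L\<^sup>1\<close>.\<close>

definition frag_semigroup :: "real measure \<Rightarrow> (real \<Rightarrow> real) \<Rightarrow> real \<Rightarrow> real \<Rightarrow> real" where
  "frag_semigroup k0 f t x = exp (- t) * (\<Sum>n. t ^ n / fact n * (gain k0 ^^ n) f x)"

lemma exp_series_sums:
  fixes c k :: "'a::{real_normed_field, banach}"
  shows "(\<lambda>n. of_real (t ^ n / fact n) * (c * k ^ n)) sums (c * exp (of_real t * k))"
proof -
  have "(\<lambda>n. c * ((of_real t * k) ^ n /\<^sub>R fact n)) sums (c * exp (of_real t * k))"
    by (intro sums_mult exp_converges)
  moreover have "c * ((of_real t * k) ^ n /\<^sub>R fact n) = of_real (t ^ n / fact n) * (c * k ^ n)" for n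
    by (simp add: scaleR_conv_of_real power_mult_distrib divide_inverse mult_ac)
  ultimately show ?thesis by simp
qed

context fragmentation
begin

lemma gain_iterate_measurable:
  "f \<in> borel_measurable pos_lborel \<Longrightarrow> (gain k0 ^^ n) f \<in> borel_measurable pos_lborel"
  by (induction n) (auto intro: gain_measurable)

lemma gain_iterate_nonneg:
  assumes "\<And>x. x > 0 \<Longrightarrow> f x \<ge> 0" "x > 0"
  shows "(gain k0 ^^ n) f x \<ge> 0"
  using assms(2) by (induction n arbitrary: x) (auto intro: gain_nonneg assms(1))

lemma gain_iterate_power_approx:
  assumes f: "f \<in> borel_measurable pos_lborel" and pq: "p \<ge> 1" "q \<ge> 1"
    and approx: "\<And>x. x > 0 \<Longrightarrow> x \<ge> a \<Longrightarrow> \<bar>f x - c * x powr (- q)\<bar> \<le> C * x powr (- p)"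
    and x: "x > 0" "x \<ge> a"
  shows "\<bar>(gain k0 ^^ n) f x - c * mellin_kernel k0 q ^ n * x powr (- q)\<bar>
    \<le> C * mellin_kernel k0 p ^ n * x powr (- p)"
  using x
proof (induction n arbitrary: x)
  case 0
  then show ?case using approx by simp
next
  case (Suc n)
  show ?case
    using gain_power_approx[OF gain_iterate_measurable[OF f] pq Suc.IH Suc.prems]
    by (simp add: mult_ac)
qed

text \<open>Termwise application of the bound on the iterates. The series for the power itself sums to
  \<open>e\<^bsup>(K(q)-1)t\<^esup> x\<^bsup>-q\<^esup>\<close>, and the error is dominated by the same series with \<open>p\<close> in place of \<open>q\<close>.\<close>

theorem frag_semigroup_power_approx:
  assumes f: "f \<in> borel_measurable pos_lborel" and pq: "p \<ge> 1" "q \<ge> 1"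
    and approx: "\<And>x. x > 0 \<Longrightarrow> x \<ge> a \<Longrightarrow> \<bar>f x - c * x powr (- q)\<bar> \<le> C * x powr (- p)"
    and x: "x > 0" "x \<ge> a" and t: "t \<ge> 0"
  shows "summable (\<lambda>n. t ^ n / fact n * (gain k0 ^^ n) f x)"
    and "\<bar>frag_semigroup k0 f t x - c * x powr (- q) * exp ((mellin_kernel k0 q - 1) * t)\<bar>
      \<le> C * x powr (- p) * exp ((mellin_kernel k0 p - 1) * t)"
proof -
  define m where "m = (\<lambda>n. t ^ n / fact n * (c * x powr (- q) * mellin_kernel k0 q ^ n))"
  define e where "e = (\<lambda>n. t ^ n / fact n * (C * x powr (- p) * mellin_kernel k0 p ^ n))"
  define d where "d = (\<lambda>n. t ^ n / fact n * (gain k0 ^^ n) f x - m n)"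
  have m: "m sums (c * x powr (- q) * exp (t * mellin_kernel k0 q))"
    using exp_series_sums[of t "c * x powr (- q)" "mellin_kernel k0 q"] by (simp add: m_def)
  have e: "e sums (C * x powr (- p) * exp (t * mellin_kernel k0 p))"
    using exp_series_sums[of t "C * x powr (- p)" "mellin_kernel k0 p"] by (simp add: e_def)
  have de: "norm (d n) \<le> e n" for n
  proof -
    have "d n = t ^ n / fact n * ((gain k0 ^^ n) f x - c * mellin_kernel k0 q ^ n * x powr (- q))"
      by (simp add: d_def m_def algebra_simps)
    then have "norm (d n) = t ^ n / fact n * \<bar>(gain k0 ^^ n) f x - c * mellin_kernel k0 q ^ n * x powr (- q)\<bar>"
      using t by (simp add: abs_mult)
    also have "\<dots> \<le> t ^ n / fact n * (C * mellin_kernel k0 p ^ n * x powr (- p))"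
      using t by (intro mult_left_mono gain_iterate_power_approx[OF f pq approx x]) auto
    finally show ?thesis by (simp add: e_def mult_ac)
  qed
  have d: "summable d" by (rule summable_comparison_test'[OF sums_summable[OF e]]) (rule de)
  have "norm (suminf d) \<le> suminf e" by (rule norm_suminf_le[OF de sums_summable[OF e]])
  then have le: "\<bar>suminf d\<bar> \<le> C * x powr (- p) * exp (t * mellin_kernel k0 p)"
    using sums_unique[OF e] by simp
  have *: "(\<lambda>n. t ^ n / fact n * (gain k0 ^^ n) f x) sums (suminf d + c * x powr (- q) * exp (t * mellin_kernel k0 q))"
    using sums_add[OF summable_sums[OF d] m] by (simp add: d_def)
  then show "summable (\<lambda>n. t ^ n / fact n * (gain k0 ^^ n) f x)" by (rule sums_summable)
  have ex: "exp ((b - 1) * t) = exp (- t) * exp (t * b)" for b :: real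
    by (simp add: algebra_simps flip: exp_add)
  have "frag_semigroup k0 f t x - c * x powr (- q) * exp ((mellin_kernel k0 q - 1) * t) = exp (- t) * suminf d"
    unfolding frag_semigroup_def sums_unique[OF *, symmetric] ex by (simp add: algebra_simps)
  then have "\<bar>frag_semigroup k0 f t x - c * x powr (- q) * exp ((mellin_kernel k0 q - 1) * t)\<bar> = exp (- t) * \<bar>suminf d\<bar>"
    by (simp add: abs_mult)
  also have "\<dots> \<le> exp (- t) * (C * x powr (- p) * exp (t * mellin_kernel k0 p))"
    by (intro mult_left_mono le) auto
  finally show "\<bar>frag_semigroup k0 f t x - c * x powr (- q) * exp ((mellin_kernel k0 q - 1) * t)\<bar>
      \<le> C * x powr (- p) * exp ((mellin_kernel k0 p - 1) * t)"
    unfolding ex by (simp add: mult_ac)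
qed

lemma gain_iterate_inverse_mellin:
  assumes G: "integrable lborel G" and \<nu>: "\<nu> \<ge> 1"
    and f: "\<And>x. x > 0 \<Longrightarrow> complex_of_real (f x) =
      1 / (2 * of_real pi) * (LBINT \<tau>. G \<tau> * of_real x powr (- Complex \<nu> \<tau>))"
  shows "integrable lborel (\<lambda>\<tau>. G \<tau> * mellin_kernel k0 (Complex \<nu> \<tau>) ^ n) \<and>
    (\<forall>x>0. complex_of_real ((gain k0 ^^ n) f x) = 1 / (2 * of_real pi) *
      (LBINT \<tau>. G \<tau> * mellin_kernel k0 (Complex \<nu> \<tau>) ^ n * of_real x powr (- Complex \<nu> \<tau>)))"
proof (induction n)
  case 0
  then show ?case using G f by simp
next
  case (Suc n)
  let ?G = "\<lambda>\<tau>. G \<tau> * mellin_kernel k0 (Complex \<nu> \<tau>) ^ n"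
  have eq: "?G \<tau> * mellin_kernel k0 (Complex \<nu> \<tau>) = G \<tau> * mellin_kernel k0 (Complex \<nu> \<tau>) ^ Suc n" for \<tau>
    by (simp add: mult_ac)
  from Suc have G: "integrable lborel ?G" and rep: "\<And>x. x > 0 \<Longrightarrow> complex_of_real ((gain k0 ^^ n) f x) =
      1 / (2 * of_real pi) * (LBINT \<tau>. ?G \<tau> * of_real x powr (- Complex \<nu> \<tau>))" by auto
  have "integrable lborel (\<lambda>\<tau>. ?G \<tau> * mellin_kernel k0 (Complex \<nu> \<tau>))"
    by (rule gain_inverse_mellin(1)[OF G \<nu> zero_less_one rep])
  moreover have "complex_of_real (gain k0 ((gain k0 ^^ n) f) x) = 1 / (2 * of_real pi) *
      (LBINT \<tau>. ?G \<tau> * mellin_kernel k0 (Complex \<nu> \<tau>) * of_real x powr (- Complex \<nu> \<tau>))" if "x > 0" for x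
    by (rule gain_inverse_mellin(2)[OF G \<nu> that rep])
  ultimately show ?case unfolding eq by simp
qed

text \<open>The \<open>n\<close>-th iterate of the gain operator inserts \<open>K(s)\<^sup>n\<close> into the inversion formula, and
  \<open>\<bar>K(s)\<bar> \<le> K(\<nu>)\<close> on the line \<open>Re s = \<nu>\<close> permits summation under the integral. As the left-hand
  side is real and free of \<open>\<nu>\<close>, so is the inverse Mellin integral.\<close>

theorem frag_semigroup_eq_mellin_solution:
  assumes U: "integrable lborel (\<lambda>\<tau>. mellin_datum f (Complex \<nu> \<tau>))" and \<nu>: "\<nu> \<ge> 1"
    and f: "\<And>x. x > 0 \<Longrightarrow> complex_of_real (f x) =
      1 / (2 * of_real pi) * (LBINT \<tau>. mellin_datum f (Complex \<nu> \<tau>) * of_real x powr (- Complex \<nu> \<tau>))"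
    and x: "x > 0" and t: "t \<ge> 0"
  shows "complex_of_real (frag_semigroup k0 f t x) = mellin_solution k0 f \<nu> t x"
proof -
  define U where "U = (\<lambda>\<tau>. mellin_datum f (Complex \<nu> \<tau>))"
  define K where "K = (\<lambda>\<tau>. mellin_kernel k0 (Complex \<nu> \<tau>))"
  define X where "X = (\<lambda>\<tau>. complex_of_real x powr (- Complex \<nu> \<tau>))"
  define \<kappa> where "\<kappa> = mellin_kernel k0 \<nu>"
  define h where "h = (\<lambda>n \<tau>. of_real (t ^ n / fact n) * (U \<tau> * X \<tau> * K \<tau> ^ n))"
  have UK: "integrable lborel (\<lambda>\<tau>. U \<tau> * K \<tau> ^ n)"
    and rep: "complex_of_real ((gain k0 ^^ n) f x) = 1 / (2 * of_real pi) * (LBINT \<tau>. U \<tau> * K \<tau> ^ n * X \<tau>)" for n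
    using gain_iterate_inverse_mellin[OF U \<nu> f, of n] x unfolding U_def K_def X_def by auto
  have U': "integrable lborel U" using U unfolding U_def .
  have [measurable]: "X \<in> borel_measurable lborel"
    unfolding X_def cpow_pos[OF x] Complex_eq by measurable
  have Xn: "norm (X \<tau>) = x powr (- \<nu>)" for \<tau> using x by (simp add: X_def norm_cpow)
  have Kn: "norm (K \<tau>) \<le> \<kappa>" for \<tau>
    using norm_mellin_kernel_le[of "Complex \<nu> \<tau>"] by (simp add: K_def \<kappa>_def)
  have \<kappa>0: "\<kappa> \<ge> 0" by (simp add: \<kappa>_def mellin_kernel_nonneg)
  have hi: "integrable lborel (h n)" for n
  proof -
    have [measurable]: "K \<in> borel_measurable borel" unfolding K_def by (rule mellin_kernel_measurable)
    note [measurable] = borel_measurable_integrable[OF U']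
    have "integrable lborel (\<lambda>\<tau>. U \<tau> * K \<tau> ^ n * X \<tau>)"
    proof (rule Bochner_Integration.integrable_bound)
      show "integrable lborel (\<lambda>\<tau>. x powr (- \<nu>) * norm (U \<tau> * K \<tau> ^ n))"
        by (intro integrable_mult_right integrable_norm UK)
    qed (auto simp: norm_mult Xn mult_ac)
    then have "integrable lborel (\<lambda>\<tau>. of_real (t ^ n / fact n) * (U \<tau> * K \<tau> ^ n * X \<tau>))"
      by (rule integrable_mult_right)
    then show ?thesis unfolding h_def by (simp only: mult_ac)
  qed
  have hn: "norm (h n \<tau>) \<le> t ^ n / fact n * (norm (U \<tau>) * x powr (- \<nu>) * \<kappa> ^ n)" for n \<tau>
  proof -
    have "norm (h n \<tau>) = t ^ n / fact n * (norm (U \<tau>) * x powr (- \<nu>) * norm (K \<tau>) ^ n)"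
      unfolding h_def norm_mult norm_of_real norm_power Xn using t by simp
    also have "\<dots> \<le> t ^ n / fact n * (norm (U \<tau>) * x powr (- \<nu>) * \<kappa> ^ n)"
      using t by (intro mult_left_mono power_mono Kn) auto
    finally show ?thesis .
  qed
  have s1: "summable (\<lambda>n. norm (h n \<tau>))" for \<tau>
  proof (rule summable_comparison_test')
    show "summable (\<lambda>n. t ^ n / fact n * (norm (U \<tau>) * x powr (- \<nu>) * \<kappa> ^ n))"
      using sums_summable[OF exp_series_sums[of t "norm (U \<tau>) * x powr (- \<nu>)" \<kappa>]] by simp
  qed (use hn in auto)
  have s2: "summable (\<lambda>n. LBINT \<tau>. norm (h n \<tau>))"
  proof (rule summable_comparison_test')
    show "summable (\<lambda>n. t ^ n / fact n * ((LBINT \<tau>. norm (U \<tau>)) * x powr (- \<nu>) * \<kappa> ^ n))"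
      using sums_summable[OF exp_series_sums[of t "(LBINT \<tau>. norm (U \<tau>)) * x powr (- \<nu>)" \<kappa>]] by simp
    fix n
    have "(LBINT \<tau>. norm (h n \<tau>)) \<le> (LBINT \<tau>. t ^ n / fact n * (norm (U \<tau>) * x powr (- \<nu>) * \<kappa> ^ n))"
      by (rule integral_mono) (use hi U' hn in auto)
    then show "norm (LBINT \<tau>. norm (h n \<tau>)) \<le> t ^ n / fact n * ((LBINT \<tau>. norm (U \<tau>)) * x powr (- \<nu>) * \<kappa> ^ n)"
      by simp
  qed
  have hsum: "(\<lambda>n. h n \<tau>) sums (U \<tau> * X \<tau> * exp (of_real t * K \<tau>))" for \<tau>
    unfolding h_def by (rule exp_series_sums)
  have "(\<lambda>n. LBINT \<tau>. h n \<tau>) sums (LBINT \<tau>. (\<Sum>n. h n \<tau>))"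
    by (rule sums_integral[OF hi AE_I2[OF s1] s2])
  then have "(\<lambda>n. LBINT \<tau>. h n \<tau>) sums (LBINT \<tau>. U \<tau> * X \<tau> * exp (of_real t * K \<tau>))"
    unfolding sums_unique[OF hsum, symmetric] .
  from sums_mult[OF this, of "1 / (2 * of_real pi)"]
  have "(\<lambda>n. 1 / (2 * of_real pi) * (LBINT \<tau>. h n \<tau>)) sums
      (1 / (2 * of_real pi) * (LBINT \<tau>. U \<tau> * X \<tau> * exp (of_real t * K \<tau>)))" .
  moreover have "1 / (2 * of_real pi) * (LBINT \<tau>. h n \<tau>) = complex_of_real (t ^ n / fact n * (gain k0 ^^ n) f x)" for n
  proof -
    have "(LBINT \<tau>. h n \<tau>) = of_real (t ^ n / fact n) * (LBINT \<tau>. U \<tau> * K \<tau> ^ n * X \<tau>)"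
      unfolding h_def integral_mult_right_zero by (simp only: mult_ac)
    then show ?thesis unfolding of_real_mult rep by (simp only: mult_ac)
  qed
  ultimately have "(\<lambda>n. complex_of_real (t ^ n / fact n * (gain k0 ^^ n) f x)) sums
      (1 / (2 * of_real pi) * (LBINT \<tau>. U \<tau> * X \<tau> * exp (of_real t * K \<tau>)))" by simp
  from sums_unique[OF this]
  have "(\<Sum>n. complex_of_real (t ^ n / fact n * (gain k0 ^^ n) f x)) =
      1 / (2 * of_real pi) * (LBINT \<tau>. U \<tau> * X \<tau> * exp (of_real t * K \<tau>))" ..
  moreover have "summable (\<lambda>n. t ^ n / fact n * (gain k0 ^^ n) f x)"
    using sums_summable[OF \<open>(\<lambda>n. complex_of_real _) sums _\<close>] by (simp only: summable_of_real_iff)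
  ultimately have "complex_of_real (\<Sum>n. t ^ n / fact n * (gain k0 ^^ n) f x) =
      1 / (2 * of_real pi) * (LBINT \<tau>. U \<tau> * X \<tau> * exp (of_real t * K \<tau>))"
    by (simp only: suminf_of_real)
  then have "complex_of_real (frag_semigroup k0 f t x) =
      of_real (exp (- t)) * (1 / (2 * of_real pi) * (LBINT \<tau>. U \<tau> * X \<tau> * exp (of_real t * K \<tau>)))"
    unfolding frag_semigroup_def of_real_mult by simp
  also have "\<dots> = 1 / (2 * of_real pi) * (LBINT \<tau>. of_real (exp (- t)) * (U \<tau> * X \<tau> * exp (of_real t * K \<tau>)))"
    unfolding integral_mult_right_zero by (simp only: mult_ac)
  also have "(\<lambda>\<tau>. of_real (exp (- t)) * (U \<tau> * X \<tau> * exp (of_real t * K \<tau>))) =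
      (\<lambda>\<tau>. U \<tau> * exp ((K \<tau> - 1) * of_real t) * X \<tau>)"
  proof
    fix \<tau>
    have "exp ((K \<tau> - 1) * of_real t) = exp (of_real (- t) + of_real t * K \<tau>)" by (simp add: algebra_simps)
    also have "\<dots> = of_real (exp (- t)) * exp (of_real t * K \<tau>)" unfolding exp_add exp_of_real ..
    finally show "of_real (exp (- t)) * (U \<tau> * X \<tau> * exp (of_real t * K \<tau>)) =
        U \<tau> * exp ((K \<tau> - 1) * of_real t) * X \<tau>" by (simp only: mult_ac)
  qed
  finally show ?thesis
    unfolding mellin_solution_def Let_def U_def K_def X_def .
qed

lemma gain_weighted_integrable:
  assumes "integrable pos_lborel (\<lambda>x. x powr (p - 1) * f x)" "p \<ge> 1"
  shows "integrable pos_lborel (\<lambda>x. x powr (p - 1) * gain k0 f x)"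
  by (rule weighted_integrable_of_mellin, rule gain_mellin(1)) (use assms in auto)

lemma gain_iterate_mellin:
  assumes "integrable pos_lborel (\<lambda>x. x powr (Re s - 1) * f x)" "Re s \<ge> 1"
  shows "integrable pos_lborel (\<lambda>x. x powr (Re s - 1) * (gain k0 ^^ n) f x) \<and>
    mellin_datum ((gain k0 ^^ n) f) s = mellin_kernel k0 s ^ n * mellin_datum f s"
proof (induction n)
  case (Suc n)
  then show ?case
    using gain_weighted_integrable[of "Re s" "(gain k0 ^^ n) f"] gain_mellin(2)[of s "(gain k0 ^^ n) f"] assms(2)
    by simp
qed (use assms in simp)

text \<open>For \<open>f \<ge> 0\<close> all iterates are nonnegative, so the weighted \<open>L\<^sup>1\<close> norm of the \<open>n\<close>-th iterate is
  exactly \<open>K(Re s)\<^sup>n\<close> times that of \<open>f\<close>; this is the summability needed to integrate term by term.\<close>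

theorem frag_semigroup_mellin:
  assumes f: "integrable pos_lborel (\<lambda>x. x powr (Re s - 1) * f x)" and s: "Re s \<ge> 1"
    and nonneg: "\<And>x. x > 0 \<Longrightarrow> f x \<ge> 0"
    and bound: "\<And>x. x > 0 \<Longrightarrow> f x \<le> B * x powr (- p)" and p: "p \<ge> 1" and t: "t \<ge> 0"
  shows "integrable pos_lborel (\<lambda>x. of_real x powr (s - 1) * complex_of_real (frag_semigroup k0 f t x))"
    and "mellin_datum (frag_semigroup k0 f t) s = mellin_datum f s * exp ((mellin_kernel k0 s - 1) * of_real t)"
proof -
  define \<phi> where "\<phi> = (\<lambda>n. (gain k0 ^^ n) f)"
  define h where "h = (\<lambda>n x. of_real x powr (s - 1) * complex_of_real (t ^ n / fact n * \<phi> n x))"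
  have \<phi>: "integrable pos_lborel (\<lambda>x. x powr (Re s - 1) * \<phi> n x)"
      "mellin_datum (\<phi> n) s = mellin_kernel k0 s ^ n * mellin_datum f s" for n
    using gain_iterate_mellin[OF f s, of n] by (auto simp: \<phi>_def)
  have \<phi>0: "x > 0 \<Longrightarrow> \<phi> n x \<ge> 0" for n x
    unfolding \<phi>_def by (rule gain_iterate_nonneg[OF nonneg])
  have \<phi>s: "summable (\<lambda>n. t ^ n / fact n * \<phi> n x)" if "x > 0" for x
    unfolding \<phi>_def
    by (rule frag_semigroup_power_approx(1)[OF measurable_of_weighted[OF f] p p, of 0 0 B])
       (use that t nonneg bound in auto)
  have hi: "integrable pos_lborel (h n)"
    and hval: "(LINT x|pos_lborel. h n x) = of_real (t ^ n / fact n) * (mellin_datum f s * mellin_kernel k0 s ^ n)" for n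
  proof -
    have h: "h n = (\<lambda>x. of_real (t ^ n / fact n) * (of_real x powr (s - 1) * complex_of_real (\<phi> n x)))"
      unfolding h_def of_real_mult by (simp only: mult_ac)
    show "integrable pos_lborel (h n)"
      unfolding h by (intro integrable_mult_right integrable_mellin \<phi>)
    show "(LINT x|pos_lborel. h n x) = of_real (t ^ n / fact n) * (mellin_datum f s * mellin_kernel k0 s ^ n)"
      unfolding h integral_mult_right_zero mellin_datum_eq[symmetric] \<phi>(2) by (simp only: mult_ac)
  qed
  define \<mu> where "\<mu> = (LINT x|pos_lborel. x powr (Re s - 1) * f x)"
  have hn: "norm (h n x) = t ^ n / fact n * (x powr (Re s - 1) * \<phi> n x)" if "x > 0" for n x
    unfolding h_def norm_mult norm_of_real norm_cpow[OF that] using t \<phi>0[OF that]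
    by (simp add: abs_mult)
  have s1: "AE x in pos_lborel. summable (\<lambda>n. norm (h n x))"
  proof (rule AE_I2)
    fix x assume "x \<in> space pos_lborel"
    then have x: "x > 0" by simp
    have "summable (\<lambda>n. x powr (Re s - 1) * (t ^ n / fact n * \<phi> n x))"
      by (rule summable_mult[OF \<phi>s[OF x]])
    then show "summable (\<lambda>n. norm (h n x))" unfolding hn[OF x] by (simp only: mult_ac)
  qed
  have "(LINT x|pos_lborel. norm (h n x)) = t ^ n / fact n * (\<mu> * mellin_kernel k0 (Re s) ^ n)" for n
  proof -
    have "complex_of_real (LINT x|pos_lborel. x powr (Re s - 1) * \<phi> n x) = mellin_datum (\<phi> n) (of_real (Re s))"
      by (rule mellin_datum_of_real[symmetric])
    also have "\<dots> = mellin_kernel k0 (of_real (Re s)) ^ n * mellin_datum f (of_real (Re s))"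
      using gain_iterate_mellin[of "of_real (Re s)" f n] f s by (simp add: \<phi>_def)
    also have "\<dots> = of_real (mellin_kernel k0 (Re s) ^ n * \<mu>)"
      unfolding mellin_kernel_of_real mellin_datum_of_real \<mu>_def by simp
    finally have "(LINT x|pos_lborel. x powr (Re s - 1) * \<phi> n x) = mellin_kernel k0 (Re s) ^ n * \<mu>"
      unfolding of_real_eq_iff .
    moreover have "(LINT x|pos_lborel. norm (h n x)) = (LINT x|pos_lborel. t ^ n / fact n * (x powr (Re s - 1) * \<phi> n x))"
      by (rule Bochner_Integration.integral_cong) (auto simp: hn)
    ultimately show ?thesis by simp
  qed
  then have s2: "summable (\<lambda>n. LINT x|pos_lborel. norm (h n x))"
    using sums_summable[OF exp_series_sums[of t \<mu> "mellin_kernel k0 (Re s)"]] by simp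
  have hsum: "(\<Sum>n. h n x) = of_real (exp t) * (of_real x powr (s - 1) * complex_of_real (frag_semigroup k0 f t x))"
    if "x > 0" for x
  proof -
    have "(\<Sum>n. h n x) = of_real x powr (s - 1) * (\<Sum>n. complex_of_real (t ^ n / fact n * \<phi> n x))"
      unfolding h_def using \<phi>s[OF that] by (intro suminf_mult) (simp only: summable_of_real)
    also have "(\<Sum>n. complex_of_real (t ^ n / fact n * \<phi> n x)) = of_real (\<Sum>n. t ^ n / fact n * \<phi> n x)"
      by (rule suminf_of_real[OF \<phi>s[OF that], symmetric])
    also have "(\<Sum>n. t ^ n / fact n * \<phi> n x) = exp t * frag_semigroup k0 f t x"
      unfolding frag_semigroup_def \<phi>_def by (simp add: exp_minus)
    finally show ?thesis unfolding of_real_mult by (simp only: mult_ac)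
  qed
  have "integrable pos_lborel (\<lambda>x. \<Sum>n. h n x)" by (rule integrable_suminf[OF hi s1 s2])
  then have i: "integrable pos_lborel (\<lambda>x. of_real (exp t) * (of_real x powr (s - 1) * complex_of_real (frag_semigroup k0 f t x)))"
    by (rule Bochner_Integration.integrable_cong[OF refl, THEN iffD1, rotated]) (simp add: hsum)
  then show "integrable pos_lborel (\<lambda>x. of_real x powr (s - 1) * complex_of_real (frag_semigroup k0 f t x))"
    using integrable_mult_right[OF i, of "inverse (of_real (exp t))"]
    by (simp only: mult.assoc[symmetric] left_inverse of_real_eq_0_iff exp_not_eq_zero not_False_eq_True mult_1_left)
  have "(LINT x|pos_lborel. (\<Sum>n. h n x)) = (\<Sum>n. LINT x|pos_lborel. h n x)"
    by (rule integral_suminf[OF hi s1 s2])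
  also have "\<dots> = mellin_datum f s * exp (of_real t * mellin_kernel k0 s)"
    unfolding hval by (rule sums_unique[OF exp_series_sums, symmetric])
  finally have "mellin_datum f s * exp (of_real t * mellin_kernel k0 s) = (LINT x|pos_lborel. (\<Sum>n. h n x))" ..
  also have "\<dots> = (LINT x|pos_lborel. of_real (exp t) * (of_real x powr (s - 1) * complex_of_real (frag_semigroup k0 f t x)))"
    by (rule Bochner_Integration.integral_cong) (auto simp: hsum)
  also have "\<dots> = exp (of_real t) * mellin_datum (frag_semigroup k0 f t) s"
    unfolding integral_mult_right_zero mellin_datum_eq by (simp add: exp_of_real)
  finally have "exp (of_real t) * mellin_datum (frag_semigroup k0 f t) s = mellin_datum f s * exp (of_real t * mellin_kernel k0 s)" ..
  also have "exp (of_real t * mellin_kernel k0 s) = exp (of_real t) * exp ((mellin_kernel k0 s - 1) * of_real t)"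
    by (simp add: algebra_simps flip: exp_add)
  finally have "exp (of_real t) * mellin_datum (frag_semigroup k0 f t) s =
      exp (of_real t) * (mellin_datum f s * exp ((mellin_kernel k0 s - 1) * of_real t))"
    by (simp only: mult_ac)
  then show "mellin_datum (frag_semigroup k0 f t) s = mellin_datum f s * exp ((mellin_kernel k0 s - 1) * of_real t)"
    by (simp only: mult_cancel_left exp_not_eq_zero simp_thms)
qed

section \<open>Uniqueness of the solution\<close>

text \<open>Since the Mellin transform at \<open>s\<close> is a continuous functional on the weighted space,
  \<open>M(t) = \<integral> x\<^bsup>s-1\<^esup> u(t,x) dx\<close> is continuous on \<open>[0, \<infinity>)\<close>, differentiable for \<open>t > 0\<close>, and the
  equation becomes \<open>M' = (K(s) - 1) M\<close>.\<close>

theorem solution_mellin: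
  assumes sol: "fragmentation_solution k0 f u" and f: "in_wL1 f"
    and s: "1 \<le> Re s" "Re s \<le> 2" and t: "t \<ge> 0"
  shows "mellin_datum (u t) s = mellin_datum f s * exp ((mellin_kernel k0 s - 1) * of_real t)"
proof -
  define M where "M = (\<lambda>t. mellin_datum (u t) s)"
  define \<beta> where "\<beta> = mellin_kernel k0 s - 1"
  have cont: "wL1_continuous_on {0..} u" and init: "AE x in lborel. x > 0 \<longrightarrow> u 0 x = f x"
    using sol by (auto simp: fragmentation_solution_def)
  obtain du where du: "\<And>t. t > 0 \<Longrightarrow> wL1_has_derivative u (du t) t"
    and eq: "\<And>t. t > 0 \<Longrightarrow> AE x in lborel. x > 0 \<longrightarrow> du t x + u t x = gain k0 (u t) x"
    using sol unfolding fragmentation_solution_def gain_def by blast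
  have uL: "in_wL1 (u t)" if "t \<ge> 0" for t using cont that by (auto simp: wL1_continuous_on_def)
  have dL: "in_wL1 (du t)" if "t > 0" for t using du[OF that] by (simp add: wL1_has_derivative_def)
  note w = in_wL1_weighted[OF _ s]
  have Mdiff: "mellin_datum (\<lambda>x. g x - h x) s = mellin_datum g s - mellin_datum h s"
    "in_wL1 (\<lambda>x. g x - h x)" if "in_wL1 g" "in_wL1 h" for g h
    using mellin_datum_lincomb[OF w[OF that(1)] w[OF that(2)], of 1 "-1"] in_wL1_lincomb[OF that, of 1 "-1"] by auto
  have M0: "M 0 = mellin_datum f s"
    unfolding M_def by (rule mellin_datum_cong_AE[OF w[OF uL] w[OF f] init]) simp
  have Mcont: "continuous_on {0..} M"
    unfolding continuous_on_def
  proof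
    fix t :: real assume t: "t \<in> {0..}"
    have "((\<lambda>r. norm (M r - M t)) \<longlongrightarrow> 0) (at t within {0..})"
    proof (rule tendsto_sandwich[OF _ _ tendsto_const])
      show "((\<lambda>r. wL1_norm (\<lambda>x. u r x - u t x)) \<longlongrightarrow> 0) (at t within {0..})"
        using cont t by (auto simp: wL1_continuous_on_def)
      show "\<forall>\<^sub>F r in at t within {0..}. norm (M r - M t) \<le> wL1_norm (\<lambda>x. u r x - u t x)"
        unfolding eventually_at_filter
      proof (rule always_eventually, intro allI impI)
        fix r :: real assume "r \<in> {0..}"
        then show "norm (M r - M t) \<le> wL1_norm (\<lambda>x. u r x - u t x)"
          using norm_mellin_datum_le[OF Mdiff(2) s, of "u r" "u t"] Mdiff(1)[of "u r" "u t"] uL t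
          by (simp add: M_def)
      qed
    qed simp
    then have "((\<lambda>r. M r - M t) \<longlongrightarrow> 0) (at t within {0..})" by (rule tendsto_norm_zero_cancel)
    then show "(M \<longlongrightarrow> M t) (at t within {0..})" by (simp add: LIM_zero_iff)
  qed
  have Mdu: "mellin_datum (du t) s = \<beta> * M t" if t: "t > 0" for t
  proof -
    have g: "integrable pos_lborel (\<lambda>x. x powr (Re s - 1) * gain k0 (u t) x)"
      using gain_weighted_integrable[OF w[OF uL]] s t by simp
    have "mellin_datum (\<lambda>x. 1 * du t x + 1 * u t x) s = mellin_datum (gain k0 (u t)) s"
      by (rule mellin_datum_cong_AE[OF w[OF in_wL1_lincomb[OF dL uL]] g]) (use eq[OF t] t in auto)
    also have "\<dots> = mellin_kernel k0 s * M t"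
      unfolding M_def by (rule gain_mellin(2)[OF w[OF uL] s(1)]) (use t in simp)
    finally show ?thesis
      using mellin_datum_lincomb[OF w[OF dL[OF t]] w[OF uL], of t 1 1] t by (simp add: M_def \<beta>_def algebra_simps)
  qed
  have Mderiv: "(M has_vector_derivative \<beta> * M t) (at t)" if t: "t > 0" for t
    unfolding has_vector_derivative_def has_derivative_at
  proof
    show "bounded_linear (\<lambda>h. h *\<^sub>R (\<beta> * M t))" by (rule bounded_linear_scaleR_left)
    show "(\<lambda>h. norm (M (t + h) - M t - h *\<^sub>R (\<beta> * M t)) / norm h) \<midarrow>0\<rightarrow> 0"
    proof (rule tendsto_sandwich[OF _ _ tendsto_const])
      show "(\<lambda>h. wL1_norm (\<lambda>x. (u (t + h) x - u t x) / h - du t x)) \<midarrow>0\<rightarrow> 0"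
        using du[OF t] by (simp add: wL1_has_derivative_def)
      have "\<forall>\<^sub>F h in at 0. \<bar>h\<bar> < t \<and> h \<noteq> 0"
        using t by (auto simp: eventually_at intro!: exI[of _ t])
      then show "\<forall>\<^sub>F h in at 0. norm (M (t + h) - M t - h *\<^sub>R (\<beta> * M t)) / norm h
          \<le> wL1_norm (\<lambda>x. (u (t + h) x - u t x) / h - du t x)"
      proof eventually_elim
        fix h :: real assume h: "\<bar>h\<bar> < t \<and> h \<noteq> 0"
        then have L: "in_wL1 (u (t + h))" "in_wL1 (u t)" "in_wL1 (du t)" using t by (auto intro: uL dL)
        let ?q = "\<lambda>x. (1 / h) * u (t + h) x + (- 1 / h) * u t x"
        have q: "(\<lambda>x. (u (t + h) x - u t x) / h - du t x) = (\<lambda>x. 1 * ?q x + (-1) * du t x)"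
          by (auto simp: diff_divide_distrib)
        have qL: "in_wL1 ?q" by (rule in_wL1_lincomb[OF L(1,2)])
        have "mellin_datum (\<lambda>x. (u (t + h) x - u t x) / h - du t x) s =
            (of_real (1 / h) * M (t + h) + of_real (- 1 / h) * M t) - \<beta> * M t"
          unfolding q mellin_datum_lincomb[OF w[OF qL] w[OF L(3)]]
            mellin_datum_lincomb[OF w[OF L(1)] w[OF L(2)]] Mdu[OF t] by (simp add: M_def)
        also have "\<dots> = (M (t + h) - M t - h *\<^sub>R (\<beta> * M t)) / of_real h"
          using h by (simp add: scaleR_conv_of_real field_simps)
        finally have "norm (M (t + h) - M t - h *\<^sub>R (\<beta> * M t)) / norm h =
            norm (mellin_datum (\<lambda>x. (u (t + h) x - u t x) / h - du t x) s)"
          by (simp add: norm_divide)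
        also have "\<dots> \<le> wL1_norm (\<lambda>x. (u (t + h) x - u t x) / h - du t x)"
          by (rule norm_mellin_datum_le[OF _ s]) (unfold q, rule in_wL1_lincomb[OF qL L(3)])
        finally show "norm (M (t + h) - M t - h *\<^sub>R (\<beta> * M t)) / norm h
          \<le> wL1_norm (\<lambda>x. (u (t + h) x - u t x) / h - du t x)" .
      qed
    qed simp
  qed
  \<comment> \<open>The integrating factor makes the derivative vanish; continuity at 0 includes the initial value.\<close>
  have "((\<lambda>r. 0) has_integral exp (- \<beta> * of_real t) * M t - exp (- \<beta> * of_real 0) * M 0) {0..t}"
  proof (rule fundamental_theorem_of_calculus_interior[OF t])
    show "continuous_on {0..t} (\<lambda>r. exp (- \<beta> * of_real r) * M r)"
      by (intro continuous_intros continuous_on_subset[OF Mcont]) auto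
    fix r assume "r \<in> {0<..<t}"
    then have r: "r > 0" by simp
    have "((\<lambda>z. exp (- \<beta> * z)) has_field_derivative - \<beta> * exp (- \<beta> * of_real r)) (at (of_real r))"
      by (auto intro!: derivative_eq_intros)
    then have "((\<lambda>r. exp (- \<beta> * of_real r)) has_vector_derivative - \<beta> * exp (- \<beta> * of_real r)) (at r)"
      by (rule has_vector_derivative_real_field)
    from has_vector_derivative_mult[OF this Mderiv[OF r]]
    show "((\<lambda>r. exp (- \<beta> * of_real r) * M r) has_vector_derivative 0) (at r)"
      by (simp add: algebra_simps)
  qed
  then have "exp (- \<beta> * of_real t) * M t - exp (- \<beta> * of_real 0) * M 0 = 0"
    using has_integral_unique has_integral_0 by blast
  then have "exp (- \<beta> * of_real t) * M t = M 0" by simp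
  then have "exp (\<beta> * of_real t) * (exp (- \<beta> * of_real t) * M t) = exp (\<beta> * of_real t) * M 0" by simp
  then have "M t = exp (\<beta> * of_real t) * M 0"
    by (simp flip: mult.assoc exp_add)
  then show ?thesis unfolding M0 \<beta>_def by (simp add: M_def mult.commute)
qed

text \<open>Both sides have the same Mellin transform on the line \<open>Re s = 1\<close>, on which the transform
  of every element of the weighted space exists.\<close>

theorem solution_eq_frag_semigroup:
  assumes sol: "fragmentation_solution k0 f u" and f: "in_wL1 f"
    and nonneg: "\<And>x. x > 0 \<Longrightarrow> f x \<ge> 0"
    and bound: "\<And>x. x > 0 \<Longrightarrow> f x \<le> B * x powr (- p)" and p: "p \<ge> 1" and t: "t \<ge> 0"
  shows "AE x in lborel. x > 0 \<longrightarrow> u t x = frag_semigroup k0 f t x"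
proof -
  have uL: "in_wL1 (u t)"
    using sol t by (auto simp: fragmentation_solution_def wL1_continuous_on_def)
  note w = in_wL1_weighted[OF f]
  have iu: "integrable pos_lborel (\<lambda>x. x powr (1 - 1) * u t x)"
    by (rule in_wL1_weighted[OF uL]) auto
  have "integrable pos_lborel (\<lambda>x. of_real x powr (of_real 1 - 1) * complex_of_real (frag_semigroup k0 f t x))"
    by (rule frag_semigroup_mellin(1)[OF _ _ nonneg bound p t]) (use w[of 1] in simp_all)
  then have iS: "integrable pos_lborel (\<lambda>x. x powr (1 - 1) * frag_semigroup k0 f t x)"
    by (rule weighted_integrable_of_mellin)
  have "AE x in lborel. x > 0 \<longrightarrow> 1 * u t x + (-1) * frag_semigroup k0 f t x = 0"
  proof (rule mellin_unique)
    have "integrable pos_lborel (\<lambda>x. x powr (1 - 1) * u t x - x powr (1 - 1) * frag_semigroup k0 f t x)"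
      by (rule Bochner_Integration.integrable_diff[OF iu iS])
    then show "integrable pos_lborel (\<lambda>x. x powr (1 - 1) * (1 * u t x + (-1) * frag_semigroup k0 f t x))"
      by (simp add: algebra_simps)
    fix \<tau>
    have "mellin_datum (u t) (Complex 1 \<tau>) = mellin_datum (frag_semigroup k0 f t) (Complex 1 \<tau>)"
      using solution_mellin[OF sol f, of "Complex 1 \<tau>" t] w[of 1] t
        frag_semigroup_mellin(2)[OF _ _ nonneg bound p t, of "Complex 1 \<tau>"] by simp
    then show "mellin_datum (\<lambda>x. 1 * u t x + (-1) * frag_semigroup k0 f t x) (Complex 1 \<tau>) = 0"
      using mellin_datum_lincomb[of "Complex 1 \<tau>" "u t" "frag_semigroup k0 f t" 1 "-1"] iu iS by simp
  qed
  then show ?thesis by eventually_elim auto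
qed

end

section \<open>Asymptotic behaviour\<close>

theorem theorem2p1:
  fixes k0 :: "real measure"
    and u0 u0' u0'' :: "real \<Rightarrow> real"
    and u :: "real \<Rightarrow> real \<Rightarrow> real"
    and q0 a0 r C1 C2 :: real
  assumes kernel: "fragmentation_kernel k0"
    and u0_nonneg: "\<And>x. x > 0 \<Longrightarrow> u0 x \<ge> 0"
    and u0_int: "set_integrable lborel {0<..} (\<lambda>x. u0 x * (1 + x))"
    and u0_deriv: "\<And>x. x > 0 \<Longrightarrow> (u0 has_real_derivative u0' x) (at x)"
    and u0'_deriv: "\<And>x. x > 0 \<Longrightarrow> (u0' has_real_derivative u0'' x) (at x)"
    and q0: "upper_exponent u0 = ereal q0"
    and u0'_int: "\<And>\<nu>. lower_exponent u0 < ereal \<nu> \<Longrightarrow> \<nu> < q0 \<Longrightarrow>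
          set_integrable lborel {0<..} (\<lambda>x. \<bar>u0' x\<bar> * x powr \<nu>)"
    and u0_lim: "\<And>\<nu>. lower_exponent u0 < ereal \<nu> \<Longrightarrow> \<nu> < q0 \<Longrightarrow>
          ((\<lambda>x. x powr \<nu> * u0 x) \<longlongrightarrow> 0) (at_right 0) \<and>
          ((\<lambda>x. x powr \<nu> * u0 x) \<longlongrightarrow> 0) at_top"
    and u0''_int: "\<And>\<nu>. lower_exponent u0 < ereal \<nu> \<Longrightarrow> \<nu> < q0 \<Longrightarrow>
          set_integrable lborel {0<..} (\<lambda>x. \<bar>u0'' x\<bar> * x powr (1 + \<nu>))"
    and u0'_lim: "\<And>\<nu>. lower_exponent u0 < ereal \<nu> \<Longrightarrow> \<nu> < q0 \<Longrightarrow>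
          ((\<lambda>x. x powr (1 + \<nu>) * u0' x) \<longlongrightarrow> 0) (at_right 0) \<and>
          ((\<lambda>x. x powr (1 + \<nu>) * u0' x) \<longlongrightarrow> 0) at_top"
    and constants: "a0 > 0" "r > q0" "C1 > 0" "C2 > 0"
    and u0_tail: "\<And>x. x > 1 \<Longrightarrow> \<bar>u0 x - a0 * x powr (- q0)\<bar> \<le> C1 * x powr (- r)"
    and u0'_tail: "\<And>x. x > 1 \<Longrightarrow>
          \<bar>u0' x + a0 * q0 * x powr (- q0 - 1)\<bar> \<le> C2 * x powr (- r - 1)"
    and u0''_tail: "\<And>\<nu>. q0 < \<nu> \<Longrightarrow> \<nu> < r \<Longrightarrow>
          set_integrable lborel {1<..}
            (\<lambda>x. x powr (\<nu> + 1) * \<bar>u0'' x - a0 * q0 * (q0 + 1) * x powr (- q0 - 2)\<bar>)"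
    and solution: "fragmentation_solution k0 u0 u"
  shows "\<exists>w. pointwise_version k0 u0 u w \<and>
           (\<forall>\<delta>. 0 < \<delta> \<and> \<delta> < r - q0 \<longrightarrow>
              (\<exists>C T. \<forall>t\<ge>T. \<forall>x\<ge>1. \<exists>\<epsilon>.
                 \<bar>\<epsilon>\<bar> \<le> C * exp ((mellin_kernel k0 (r - \<delta>) - mellin_kernel k0 q0) * t) \<and>
                 w t x = a0 * x powr (- q0) * exp ((mellin_kernel k0 q0 - 1) * t) * (1 + \<epsilon>)))"
proof -
  interpret fragmentation k0 by standard (rule kernel)
  have f: "in_wL1 u0" using u0_int by (simp add: in_wL1_def mult.commute)
  note weighted = in_wL1_weighted[OF f]
  have moments: "p \<in> moment_exponents u0" if "1 \<le> p" "p \<le> 2" for p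
    using weighted[OF that] by (simp add: moment_exponents_def set_integrable_pos_iff mult.commute)
  have "lower_exponent u0 \<le> ereal 1"
    unfolding lower_exponent_def by (rule Inf_lower) (use moments[of 1] in auto)
  then have lower: "lower_exponent u0 < ereal \<nu>" if "\<nu> > 1" for \<nu>
    using that by (meson ereal_less_le le_less_trans less_ereal.simps(1))
  have "ereal 2 \<le> upper_exponent u0"
    unfolding upper_exponent_def by (rule Sup_upper) (use moments[of 2] in auto)
  then have q2: "q0 \<ge> 2" using q0 by simp
  have cont: "isCont u0 x" if "x > 0" for x using u0_deriv[OF that] by (rule DERIV_isCont)
  have meas: "u0 \<in> borel_measurable pos_lborel" by (rule measurable_differentiable_pos(1)[OF u0_deriv])
  have inversion: "integrable lborel (\<lambda>\<tau>. mellin_datum u0 (Complex \<nu> \<tau>))"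
      "x > 0 \<Longrightarrow> complex_of_real (u0 x) = 1 / (2 * of_real pi) *
        (LBINT \<tau>. mellin_datum u0 (Complex \<nu> \<tau>) * of_real x powr (- Complex \<nu> \<tau>))"
      "\<exists>B. \<forall>x>0. \<bar>u0 x\<bar> \<le> B * x powr (- \<nu>)"
    if \<nu>: "\<nu> \<in> {1<..<2}" for \<nu> x
  proof -
    have \<nu>1: "\<nu> > 1" and l: "lower_exponent u0 < ereal \<nu>" and q: "\<nu> < q0"
      using \<nu> lower q2 by auto
    have int: "integrable pos_lborel (\<lambda>x. x powr (\<nu> - 1) * u0 x)" using weighted[of \<nu>] \<nu> by simp
    note all = mellin_decay_and_inversion[OF \<nu>1 u0_deriv u0'_deriv int u0'_int[OF l q] u0''_int[OF l q]
        conjunct1[OF u0_lim[OF l q]] conjunct2[OF u0_lim[OF l q]]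
        conjunct1[OF u0'_lim[OF l q]] conjunct2[OF u0'_lim[OF l q]]]
    show "integrable lborel (\<lambda>\<tau>. mellin_datum u0 (Complex \<nu> \<tau>))" by (rule all(1))
    show "x > 0 \<Longrightarrow> complex_of_real (u0 x) = 1 / (2 * of_real pi) *
        (LBINT \<tau>. mellin_datum u0 (Complex \<nu> \<tau>) * of_real x powr (- Complex \<nu> \<tau>))" by (rule all(2))
    show "\<exists>B. \<forall>x>0. \<bar>u0 x\<bar> \<le> B * x powr (- \<nu>)" by (rule all(3))
  qed
  \<comment> \<open>Any exponent in \<open>(1,2)\<close> would do; the bound is needed only for convergence of the series.\<close>
  obtain B where B: "\<And>x. x > 0 \<Longrightarrow> u0 x \<le> B * x powr (- (3 / 2))"
    using inversion(3)[of "3 / 2"] by (force dest: abs_le_D1)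
  let ?w = "frag_semigroup k0 u0"
  have "pointwise_version k0 u0 u ?w"
    unfolding pointwise_version_def
  proof (intro allI impI conjI ballI)
    fix t :: real assume t: "t > 0"
    show "AE x in lborel. x > 0 \<longrightarrow> u t x = ?w t x"
      by (rule solution_eq_frag_semigroup[OF solution f u0_nonneg B]) (use t in auto)
    fix x \<nu> :: real assume "x > 0" "\<nu> \<in> {1<..<2}"
    then show "complex_of_real (?w t x) = mellin_solution k0 u0 \<nu> t x"
      using t by (intro frag_semigroup_eq_mellin_solution inversion) auto
  qed
  moreover have tail: "\<bar>u0 x - a0 * x powr (- q0)\<bar> \<le> C1 * x powr (- r)" if "x \<ge> 1" for x
  \<comment> \<open>An atom of \<open>k\<^sub>0\<close> at 1 makes the value at 1 itself matter, hence the bound there by continuity.\<close>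
  proof (cases "x = 1")
    case True
    have c: "isCont (\<lambda>x. C1 * x powr (- r) - \<bar>u0 x - a0 * x powr (- q0)\<bar>) 1"
      by (intro continuous_intros cont) auto
    then have "((\<lambda>x. C1 * x powr (- r) - \<bar>u0 x - a0 * x powr (- q0)\<bar>) \<longlongrightarrow>
        C1 * 1 powr (- r) - \<bar>u0 1 - a0 * 1 powr (- q0)\<bar>) (at_right 1)"
      unfolding isCont_def by (rule filterlim_mono) (auto intro: at_le)
    then have "0 \<le> C1 * 1 powr (- r) - \<bar>u0 1 - a0 * 1 powr (- q0)\<bar>"
      by (rule tendsto_lowerbound)
         (auto simp: eventually_at_right_field intro!: exI[of _ 2] u0_tail)
    then show ?thesis using True by simp
  next
    case False
    then show ?thesis using that u0_tail by simp
  qed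
  moreover have "\<exists>\<epsilon>. \<bar>\<epsilon>\<bar> \<le> C1 / a0 * exp ((mellin_kernel k0 (r - \<delta>) - mellin_kernel k0 q0) * t) \<and>
      ?w t x = a0 * x powr (- q0) * exp ((mellin_kernel k0 q0 - 1) * t) * (1 + \<epsilon>)"
    if \<delta>: "0 < \<delta> \<and> \<delta> < r - q0" and t: "t \<ge> 0" and x: "x \<ge> 1" for \<delta> t x
  proof -
    define L where "L = a0 * x powr (- q0) * exp ((mellin_kernel k0 q0 - 1) * t)"
    define \<epsilon> where "\<epsilon> = ?w t x / L - 1"
    have L: "L > 0" using constants x by (simp add: L_def)
    have K: "mellin_kernel k0 r \<le> mellin_kernel k0 (r - \<delta>)"
      using \<delta> q2 by (intro mellin_kernel_antimono) auto
    have "\<epsilon> = (?w t x - L) / L" using L by (simp add: \<epsilon>_def diff_divide_distrib)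
    then have "\<bar>\<epsilon>\<bar> = \<bar>?w t x - L\<bar> / L" using L by (simp add: abs_divide)
    also have "\<dots> \<le> C1 * x powr (- r) * exp ((mellin_kernel k0 r - 1) * t) / L"
    proof (rule divide_right_mono)
      show "\<bar>?w t x - L\<bar> \<le> C1 * x powr (- r) * exp ((mellin_kernel k0 r - 1) * t)"
        unfolding L_def
        by (rule frag_semigroup_power_approx(2)[where a = 1, OF meas])
           (use x t q2 constants tail in auto)
    qed (use L in simp)
    also have "\<dots> \<le> C1 * x powr (- q0) * exp ((mellin_kernel k0 (r - \<delta>) - 1) * t) / L"
      using constants x t K L
      by (intro divide_right_mono mult_mono mult_left_mono powr_mono) (auto intro: mult_right_mono)
    also have "\<dots> = C1 / a0 * exp ((mellin_kernel k0 (r - \<delta>) - mellin_kernel k0 q0) * t)"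
    proof -
      have "exp ((mellin_kernel k0 (r - \<delta>) - 1) * t) =
          exp ((mellin_kernel k0 (r - \<delta>) - mellin_kernel k0 q0) * t) * exp ((mellin_kernel k0 q0 - 1) * t)"
        by (simp add: algebra_simps flip: exp_add)
      then show ?thesis using constants x by (simp add: L_def)
    qed
    finally have "\<bar>\<epsilon>\<bar> \<le> C1 / a0 * exp ((mellin_kernel k0 (r - \<delta>) - mellin_kernel k0 q0) * t)" .
    moreover have "?w t x = L * (1 + \<epsilon>)" using L by (simp add: \<epsilon>_def)
    ultimately show ?thesis unfolding L_def by blast
  qed
  ultimately show ?thesis by blast
qed

end
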